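(* Let $A$ be a commutative real C$^*$-algebra and let $V: A\times A\to\mathbb{R}$ be a continuous orthogonal form. Then there exist functionals $\varphi_1,\varphi_2\in A^{*}$ such that $$V(x,y)=\varphi_1(xy)+\varphi_2(xy^* )\qquad\text{for all } x,y\in A.$$
   Context: A real C$^*$-algebra is a real Banach $*$-algebra $A$ satisfying $\|a^*a\|=\|a\|^2$ for all $a\in A$ and such that $1+a^*a$ is invertible in the unitization of $A$ for every $a\in A$ (equivalently, a norm-closed real $*$-subalgebra of the bounded operators on a real Hilbert space, up to isometric $*$-isomorphism). No unit is assumed. $A^*$ denotes the space of bounded real-linear functionals $A\to\mathbb{R}$. Elements $a,b\in A$ are orthogonal, written $a\perp b$, if $ab^*=b^*a=0$. A form is a bounded bilinear map $V:A\times A\to\mathbb{R}$; it is orthogonal if $V(a,b^* )=0$ whenever $a\perp b$ in $A$. *)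

theory Defs
  imports "HOL-Analysis.Analysis"
begin

class real_banach_star_algebra = real_normed_algebra + banach +
  fixes star :: "'a \<Rightarrow> 'a"
  assumes star_add: "star (a + b) = star a + star b"
    and star_scaleR: "star (scaleR r a) = scaleR r (star a)"
    and star_mult: "star (a * b) = star b * star a"
    and star_star: "star (star a) = a"

text \<open>
  The unitization of an algebra \<open>A\<close> is \<open>A \<times> \<real>\<close>, where \<open>(a, s)\<close> stands for \<open>a + s 1\<close>.  A unit
  is adjoined even if \<open>A\<close> already has one; for elements of the form \<open>1 + a\<close>, invertibility does
  not depend on which of the two units is meant.
\<close>

definition (in real_algebra) unitization_mult :: "'a \<times> real \<Rightarrow> 'a \<times> real \<Rightarrow> 'a \<times> real"
  where "unitization_mult x y =
    (fst x * fst y + scaleR (snd x) (fst y) + scaleR (snd y) (fst x), snd x * snd y)"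

definition (in real_algebra) unitization_one :: "'a \<times> real"
  where "unitization_one = (0, 1)"

definition (in real_algebra) unitization_invertible :: "'a \<times> real \<Rightarrow> bool"
  where "unitization_invertible x \<longleftrightarrow>
    (\<exists>y. unitization_mult x y = unitization_one \<and> unitization_mult y x = unitization_one)"

class real_cstar_algebra = real_banach_star_algebra +
  assumes norm_star_mult_self: "norm (star a * a) = (norm a)\<^sup>2"
    and invertible_one_plus_star_mult_self:
      "unitization_invertible (star a * a, 1)"

definition orthogonal_elements :: "'a::real_cstar_algebra \<Rightarrow> 'a \<Rightarrow> bool"
  where "orthogonal_elements a b \<longleftrightarrow> a * star b = 0 \<and> star b * a = 0"

definition orthogonal_form :: "('a::real_cstar_algebra \<Rightarrow> 'a \<Rightarrow> real) \<Rightarrow> bool"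
  where "orthogonal_form V \<longleftrightarrow>
    bounded_bilinear V \<and> (\<forall>a b. orthogonal_elements a b \<longrightarrow> V a (star b) = 0)"

end

theory Submission imports Defs begin

text \<open>
  In a commutative algebra \<open>a \<perp> b\<^sup>*\<close> says that \<open>a b = 0\<close>, so an orthogonal form satisfies
  \<open>V a b = 0\<close> whenever \<open>a b = 0\<close>. Gelfand theory identifies the elements of \<open>A\<close> with complex
  functions on a space of points: self-adjoint elements are the real functions in \<open>A\<close>, skew elements
  the purely imaginary ones. A form that vanishes on pairs with product zero should
  live on the diagonal of the space of points, and thus depend only on the pointwise data
  \<open>x y\<close> and \<open>x y\<^sup>*\<close>. The functionals come from the following three facts.

  \<^item> Multiplication by a self-adjoint \<open>h\<close> moves across the form: \<open>V (h x) y = V x (h y)\<close> (lemma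
    \<open>balanced\<close>). On a grid of mesh \<open>\<delta>\<close>, the tent functions \<open>d\<^sub>i(h)\<close> form a partition of unity,
    and only the neighbouring pairs \<open>\<bar>i - j\<bar> = 1\<close> contribute to the difference of the two sides,
    each with a factor \<open>\<delta>\<close>. Their sum is bounded independently of the grid by averaging over
    random signs.

  \<^item> If one argument is self-adjoint, then an approximate unit \<open>e\<close> gives
    \<open>V a y \<approx> V (e a) y = V e (a y)\<close>, which is a bounded functional of \<open>a y\<close>
    (lemma \<open>selfadjoint_left_functional\<close>; the other argument is treated by symmetry).

  \<^item> If both arguments are skew, there may be no skew element of modulus one to play the role of \<open>e\<close>:
    the space of points can be a nontrivial double cover. For any finite set of skew
    elements there are, however, finitely many skew \<open>c\<^sub>j\<close> such that \<open>e = \<Sum> \<bar>c\<^sub>j\<bar>\<^sup>2\<close> acts almost as a unit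
    on the set, and \<open>w x = - \<Sum> V c\<^sub>j (c\<^sub>j x)\<close> satisfies \<open>w (b d) = V (e b) d\<close>, so \<open>w (e b d)\<close> is close to
    \<open>V b d\<close>. The difficulty is to bound \<open>x \<mapsto> w (e x)\<close> independently of the number of the \<open>c\<^sub>j\<close>. Lemma \<open>trace_form_e_bound\<close> does it in the manner of
    Grothendieck's inequality: with random signs, \<open>f = \<Sum> \<plusminus>c\<^sub>j\<close> has mean square \<open>e\<close>, and it splits into
    a bounded part and a part whose mean square is at most one half of \<open>e\<close>, which is absorbed.

  In the last two cases the functionals are limits of the approximating ones by compactness of bounded sets of
  functionals (lemma \<open>functional_of_finite_approximations\<close>). Splitting \<open>x\<close> and \<open>y\<close> into
  self-adjoint and skew parts then gives \<open>\<phi>\<^sub>1\<close> and \<open>\<phi>\<^sub>2\<close>.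

  The Gelfand theory is developed from the axioms. The norm of a self-adjoint element \<open>h\<close> is, up to
  sign, in its spectrum (theorem \<open>norm_in_spectrum\<close>, a resolvent argument), and
  sums of squares become invertible after adding 1. Hence there is a preordering of the
  algebra that contains all squares and both \<open>\<parallel>h\<parallel>\<^sup>2 - h\<^sup>2\<close> and its negative; a maximal one is a total order,
  and comparison with the real numbers turns it into a character that attains the norm of \<open>h\<close>
  (theorem \<open>character_norm_attained\<close>). Characters of the self-adjoint part extend to complex points
  of \<open>A\<close>.
\<close>

section \<open>Adjoining a unit\<close>

text \<open>
  \<open>Unital a s\<close> stands for \<open>a + s 1\<close>. A type of its own makes the unitization a commutative
  Banach algebra with unit, in which invertibility is divisibility of 1.
\<close>
datatype 'a unital = Unital (alg: 'a) (scal: real)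

lemma unital_eq_iff: "x = y \<longleftrightarrow> alg x = alg y \<and> scal x = scal y"
  by (cases x; cases y) auto

instantiation unital :: ("{real_algebra, comm_ring}") "{comm_ring_1, real_algebra_1}"
begin

definition "0 = Unital 0 0"
definition "1 = Unital 0 1"
definition "x + y = Unital (alg x + alg y) (scal x + scal y)"
definition "- x = Unital (- alg x) (- scal x)"
definition "x - y = Unital (alg x - alg y) (scal x - scal y)"
definition "x * y = Unital (alg x * alg y + scal x *\<^sub>R alg y + scal y *\<^sub>R alg x) (scal x * scal y)"
definition "r *\<^sub>R x = Unital (r *\<^sub>R alg x) (r * scal x)"

lemma unital_sel [simp]:
  "alg 0 = 0" "scal 0 = 0" "alg 1 = 0" "scal 1 = 1"
  "alg (x + y) = alg x + alg y" "scal (x + y) = scal x + scal y"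
  "alg (- x) = - alg x" "scal (- x) = - scal x"
  "alg (x - y) = alg x - alg y" "scal (x - y) = scal x - scal y"
  "alg (x * y) = alg x * alg y + scal x *\<^sub>R alg y + scal y *\<^sub>R alg x"
  "scal (x * y) = scal x * scal y"
  "alg (r *\<^sub>R x) = r *\<^sub>R alg x" "scal (r *\<^sub>R x) = r * scal x"
  by (simp_all add: zero_unital_def one_unital_def plus_unital_def uminus_unital_def
      minus_unital_def times_unital_def scaleR_unital_def)

instance
  by standard (simp_all add: unital_eq_iff algebra_simps)

end

instantiation unital :: ("{real_normed_algebra, comm_ring}") real_normed_algebra_1
begin

definition "norm x = norm (alg x) + \<bar>scal x\<bar>"
definition "sgn x = inverse (norm x) *\<^sub>R (x :: 'a unital)"
definition "dist x y = norm (x - y :: 'a unital)"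
definition uniformity_unital :: "('a unital \<times> 'a unital) filter"
  where "uniformity_unital = (INF e\<in>{0 <..}. principal {(x, y). dist x y < e})"
definition open_unital :: "'a unital set \<Rightarrow> bool"
  where "open_unital U \<longleftrightarrow> (\<forall>x\<in>U. eventually (\<lambda>(x', y). x' = x \<longrightarrow> y \<in> U) uniformity)"

instance
proof
  fix x y :: "'a unital" and r :: real and U :: "'a unital set"
  show "norm (x + y) \<le> norm x + norm y"
    using norm_triangle_ineq[of "alg x" "alg y"] by (simp add: norm_unital_def)
  show "norm (x * y) \<le> norm x * norm y"
  proof -
    have "norm (alg (x * y)) \<le> norm (alg x * alg y) + norm (scal x *\<^sub>R alg y) + norm (scal y *\<^sub>R alg x)"
      by (simp add: norm_triangle_le)
    also have "\<dots> \<le> norm (alg x) * norm (alg y) + \<bar>scal x\<bar> * norm (alg y) + \<bar>scal y\<bar> * norm (alg x)"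
      using norm_mult_ineq[of "alg x" "alg y"] by simp
    finally show ?thesis by (simp add: norm_unital_def algebra_simps abs_mult)
  qed
qed (auto simp: norm_unital_def sgn_unital_def dist_unital_def uniformity_unital_def open_unital_def
       unital_eq_iff abs_mult algebra_simps add_nonneg_eq_0_iff)

end

instance unital :: ("{real_normed_algebra, comm_ring, banach}") banach
proof
  fix X :: "nat \<Rightarrow> 'a unital"
  assume X: "Cauchy X"
  have n: "norm (alg x) \<le> norm x" "\<bar>scal x\<bar> \<le> norm x" for x :: "'a unital"
    by (auto simp: norm_unital_def)
  have "Cauchy (\<lambda>n. alg (X n))"
    using X n(1)[of "X _ - X _"] unfolding Cauchy_iff unital_sel by (meson le_less_trans)
  moreover have "Cauchy (\<lambda>n. scal (X n))"
    using X n(2)[of "X _ - X _"] unfolding Cauchy_iff unital_sel real_norm_def by (meson le_less_trans)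
  ultimately obtain a s where lim: "(\<lambda>n. alg (X n)) \<longlonglongrightarrow> a" "(\<lambda>n. scal (X n)) \<longlonglongrightarrow> s"
    unfolding Cauchy_convergent_iff convergent_def by blast
  have "(\<lambda>n. norm (alg (X n) - a) + \<bar>scal (X n) - s\<bar>) \<longlonglongrightarrow> norm (a - a) + \<bar>s - s\<bar>"
    by (intro tendsto_intros lim)
  then have "X \<longlonglongrightarrow> Unital a s"
    unfolding tendsto_dist_iff[of X] by (simp add: dist_unital_def norm_unital_def)
  then show "convergent X" by (auto simp: convergent_def)
qed

abbreviation emb :: "'a::{real_algebra, comm_ring} \<Rightarrow> 'a unital"
  where "emb a \<equiv> Unital a 0"

lemma emb_simps:
  "emb (a + b) = emb a + emb b" "emb (a - b) = emb a - emb b" "emb (a * b) = emb a * emb b"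
  "emb (r *\<^sub>R a) = r *\<^sub>R emb a"
  by (simp_all add: unital_eq_iff)

lemma scal_of_real [simp]: "scal (of_real r) = r" "alg (of_real r) = 0"
  by (simp_all add: of_real_def)

lemma unital_decomp: "x = emb (alg x) + of_real (scal x)"
  by (simp add: unital_eq_iff)

text \<open>
  The properties of the self-adjoint part of a commutative real C*-algebra that make it an algebra of
  real functions. The second one says that \<open>1 + a\<^sup>2\<close> has the inverse \<open>1 + b\<close> in the unitization.
\<close>
class real_square_algebra = real_normed_algebra + comm_ring + banach +
  assumes norm_square: "norm (a * a) = (norm a)\<^sup>2"
    and one_plus_square_invertible: "\<exists>b. a * a + b + a * a * b = 0"

lemma is_unit_scaleR:
  fixes x :: "'u::{real_algebra_1, comm_ring_1}"
  assumes "r \<noteq> 0"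
  shows "r *\<^sub>R x dvd 1 \<longleftrightarrow> x dvd 1"
proof
  assume "x dvd 1"
  then obtain y where "1 = x * y" by (elim dvdE)
  then have "1 = r *\<^sub>R x * (inverse r *\<^sub>R y)" using assms by simp
  then show "r *\<^sub>R x dvd 1" by (rule dvdI)
next
  assume "r *\<^sub>R x dvd 1"
  then obtain y where "1 = r *\<^sub>R x * y" by (elim dvdE)
  then have "1 = x * (r *\<^sub>R y)" by simp
  then show "x dvd 1" by (rule dvdI)
qed

lemma is_unit_one_plus_square_emb:
  fixes a :: "'a::real_square_algebra"
  shows "1 + (emb a)\<^sup>2 dvd 1"
proof -
  obtain b where b: "a * a + b + a * a * b = 0" using one_plus_square_invertible by blast
  have "(1 + (emb a)\<^sup>2) * (1 + emb b) = 1"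
    using b by (simp add: unital_eq_iff power2_eq_square algebra_simps)
  then show ?thesis by (rule dvdI[OF sym])
qed

text \<open>
  The class gives this only for \<open>y\<close> in the algebra itself. For \<open>y = b + s\<close> and \<open>\<rho> = 1 + s\<^sup>2\<close>, the
  quadratic \<open>1 + y\<^sup>2 = \<rho> + 2 s b + b\<^sup>2\<close> has the root \<open>b = i - s\<close>. Since \<open>i\<close> is a real
  combination of \<open>b\<close> and \<open>b\<^sup>2\<close> at this root, \<open>1 + y\<^sup>2\<close> divides an expression \<open>\<rho>\<^sup>2 (1 + c\<^sup>2)\<close> in which
  \<open>c\<close> has no unit part.
\<close>
lemma is_unit_one_plus_square:
  fixes y :: "'a::real_square_algebra unital"
  shows "1 + y\<^sup>2 dvd 1"
proof -
  define s where "s = scal y"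
  define \<rho> where "\<rho> = 1 + s\<^sup>2"
  define S R B where SRB: "S = (of_real s :: 'a unital)" "R = (of_real \<rho> :: 'a unital)" "B = emb (alg y)"
  have \<rho>: "\<rho> > 0" unfolding \<rho>_def by (simp add: add_pos_nonneg)
  have R: "R = 1 + S\<^sup>2" by (simp add: SRB \<rho>_def)
  have y: "y = B + S" unfolding SRB s_def by (rule unital_decomp)
  (* solves i = x (u + v x) with u = (1 - s^2) / rho, v = - s / rho at the root x = i - s *)
  define c where "c = (1 / \<rho>) *\<^sub>R ((1 - s\<^sup>2) *\<^sub>R alg y - s *\<^sub>R (alg y * alg y))"
  have "R * emb c = B * ((1 - S\<^sup>2) - S * B)"
    using \<rho> by (simp add: c_def SRB unital_eq_iff algebra_simps power2_eq_square of_real_def)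
  then have "R\<^sup>2 * (1 + (emb c)\<^sup>2) = R\<^sup>2 + (B * ((1 - S\<^sup>2) - S * B))\<^sup>2"
    by (metis (no_types) distrib_left mult.right_neutral power_mult_distrib)
  also have "\<dots> = (1 + y\<^sup>2) * (R - 2 * S * B + S\<^sup>2 * B\<^sup>2)"
    unfolding R y by (simp add: algebra_simps power2_eq_square)
  finally have "(1 + y\<^sup>2) dvd R\<^sup>2 * (1 + (emb c)\<^sup>2)" by simp
  moreover have "R\<^sup>2 * (1 + (emb c)\<^sup>2) = \<rho>\<^sup>2 *\<^sub>R (1 + (emb c)\<^sup>2)"
    by (simp add: SRB scaleR_conv_of_real)
  ultimately show ?thesis
    using is_unit_scaleR[of "\<rho>\<^sup>2" "1 + (emb c)\<^sup>2"] is_unit_one_plus_square_emb[of c] \<rho>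
    by (metis dvd_trans less_irrefl zero_less_power)
qed

section \<open>The norm lies in the spectrum\<close>
lemma inverse_bounded_near:
  fixes x :: "'u::{real_normed_algebra_1, comm_ring_1}"
  assumes "x * y = 1" "x' * y' = 1" "norm (x' - x) * norm y \<le> 1 / 2"
  shows "norm (y' - y) \<le> 2 * (norm y)\<^sup>2 * norm (x' - x)"
proof -
  have eq: "y' - y = y * y' * (x - x')"
  proof -
    have "y * y' * (x - x') = (x * y) * y' - (x' * y') * y" by (simp add: algebra_simps)
    then show ?thesis using assms by simp
  qed
  have "norm (y * y' * (x - x')) \<le> norm (y * y') * norm (x - x')" by (rule norm_mult_ineq)
  also have "\<dots> \<le> norm y * norm y' * norm (x - x')"
    by (intro mult_right_mono norm_mult_ineq) simp
  finally have n: "norm (y' - y) \<le> norm y * norm y' * norm (x' - x)"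
    unfolding eq by (simp add: norm_minus_commute)
  also have "norm y * norm y' * norm (x' - x) = norm y' * (norm (x' - x) * norm y)" by simp
  also have "\<dots> \<le> norm y' * (1 / 2)" by (intro mult_left_mono assms) auto
  finally have "norm y' \<le> 2 * norm y" using norm_triangle_ineq2[of y' y] by simp
  then have "norm y * norm y' * norm (x' - x) \<le> norm y * (2 * norm y) * norm (x' - x)"
    by (intro mult_right_mono mult_left_mono) auto
  with n show ?thesis by (simp add: power2_eq_square)
qed

lemma continuous_on_inverse_section:
  fixes f g :: "'t::metric_space \<Rightarrow> 'u::{real_normed_algebra_1, comm_ring_1}"
  assumes f: "continuous_on S f" and fg: "\<And>t. t \<in> S \<Longrightarrow> f t * g t = 1"
  shows "continuous_on S g"
  unfolding continuous_on_def
proof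
  fix t assume t: "t \<in> S"
  have lim: "((\<lambda>s. norm (f s - f t)) \<longlongrightarrow> 0) (at t within S)"
  proof (rule tendsto_norm_zero, rule LIM_zero)
    show "(f \<longlongrightarrow> f t) (at t within S)" using f t unfolding continuous_on_def by blast
  qed
  have lim1: "((\<lambda>s. norm (f s - f t) * norm (g t)) \<longlongrightarrow> 0 * norm (g t)) (at t within S)"
    by (intro tendsto_intros lim)
  have mem: "\<forall>\<^sub>F s in at t within S. s \<in> S" by (simp add: eventually_at_filter)
  have small: "\<forall>\<^sub>F s in at t within S. norm (f s - f t) * norm (g t) < 1 / 2"
    using lim1 by (rule order_tendstoD) simp
  have "((\<lambda>s. 2 * (norm (g t))\<^sup>2 * norm (f s - f t)) \<longlongrightarrow> 2 * (norm (g t))\<^sup>2 * 0) (at t within S)"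
    by (intro tendsto_intros lim)
  then have "((\<lambda>s. 2 * (norm (g t))\<^sup>2 * norm (f s - f t)) \<longlongrightarrow> 0) (at t within S)" by simp
  moreover have "\<forall>\<^sub>F s in at t within S. norm (g s - g t) \<le> 2 * (norm (g t))\<^sup>2 * norm (f s - f t)"
    using small mem
  proof eventually_elim
    case (elim s)
    then show ?case
      using fg t by (intro inverse_bounded_near) auto
  qed
  ultimately have "((\<lambda>s. g s - g t) \<longlongrightarrow> 0) (at t within S)"
    by (rule Lim_null_comparison[rotated])
  then show "(g \<longlongrightarrow> g t) (at t within S)" by (rule LIM_zero_cancel)
qed

lemma scaleR_two: "2 *\<^sub>R x = 2 * (x :: 'u::real_algebra_1)"
  by (simp add: scaleR_2 mult_2)

lemma double_cancel:
  fixes x y :: "'u::real_algebra_1"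
  assumes "2 * x = 2 * y"
  shows "x = y"
  using assms unfolding scaleR_two[symmetric] by simp

text \<open>
  \<open>F t\<close> is the real part of the resolvent \<open>(1 - e\<^bsup>it\<^esup> a)\<^sup>-\<^sup>1\<close>, written without complex numbers, and
  \<open>d\<close>, \<open>e\<close> express its uniform continuity. The values at 0 and \<open>\<pi>\<close> are recorded as genuine inverses
  because a factor \<open>1 - a\<close> in \<open>F 0 (1 - a)\<^sup>2 = 1 - a\<close> need not cancel.
\<close>
definition resolvent_modulus :: "'u::{real_normed_algebra_1, comm_ring_1} \<Rightarrow> real \<Rightarrow> real \<Rightarrow> bool"
  where "resolvent_modulus a d e \<longleftrightarrow> (\<exists>F.
    (\<forall>t\<in>{0..2*pi}. F t * (1 - 2 * of_real (cos t) * a + a\<^sup>2) = 1 - of_real (cos t) * a) \<and>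
    F 0 * (1 - a) = 1 \<and> F pi * (1 + a) = 1 \<and>
    (\<forall>s\<in>{0..2*pi}. \<forall>t\<in>{0..2*pi}. \<bar>s - t\<bar> < d \<longrightarrow> norm (F s - F t) \<le> e))"

text \<open>
  Averaging the resolvents of \<open>a\<close> at \<open>t/2\<close> and \<open>t/2 + \<pi>\<close>, that is \<open>1/(1 - z a)\<close> and \<open>1/(1 + z a)\<close>, gives the
  resolvent \<open>1/(1 - z\<^sup>2 a\<^sup>2)\<close> of \<open>a\<^sup>2\<close> at \<open>t\<close>. Halving the argument doubles the modulus of continuity.
\<close>
lemma resolvent_modulus_square:
  assumes "resolvent_modulus a d e"
  shows "resolvent_modulus (a\<^sup>2) (2 * d) e"
proof -
  obtain F where
    F': "\<forall>t\<in>{0..2*pi}. F t * (1 - 2 * of_real (cos t) * a + a\<^sup>2) = 1 - of_real (cos t) * a"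
    and F0: "F 0 * (1 - a) = 1" and Fpi: "F pi * (1 + a) = 1"
    and Fe': "\<forall>s\<in>{0..2*pi}. \<forall>t\<in>{0..2*pi}. \<bar>s - t\<bar> < d \<longrightarrow> norm (F s - F t) \<le> e"
    using assms unfolding resolvent_modulus_def by blast
  have F: "F t * (1 - 2 * of_real (cos t) * a + a\<^sup>2) = 1 - of_real (cos t) * a"
    if "0 \<le> t" "t \<le> 2*pi" for t
    using F' that by simp
  have Fe: "norm (F s - F t) \<le> e"
    if "0 \<le> t" "t \<le> 2*pi" "0 \<le> s" "s \<le> 2*pi" "\<bar>s - t\<bar> < d" for s t
    using Fe' that by simp
  define G where "G t = (1/2) *\<^sub>R (F (t/2) + F (t/2 + pi))" for t
  have twoG: "2 * G t = F (t/2) + F (t/2 + pi)" for t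
  proof -
    have "2 *\<^sub>R G t = F (t/2) + F (t/2 + pi)" unfolding G_def scaleR_scaleR by simp
    then show ?thesis unfolding scaleR_two .
  qed
  have 1: "G t * (1 - 2 * of_real (cos t) * a\<^sup>2 + (a\<^sup>2)\<^sup>2) = 1 - of_real (cos t) * a\<^sup>2"
    if "0 \<le> t" "t \<le> 2 * pi" for t
  proof (rule double_cancel)
    define c where "c = (of_real (cos (t/2)) :: 'a)"
    have c: "of_real (cos t) = 2 * c\<^sup>2 - 1"
    proof -
      have *: "cos t = 2 * (cos (t/2))\<^sup>2 - 1" using cos_double_cos[of "t/2"] by simp
      show ?thesis unfolding c_def * by simp
    qed
    define X Y where "X = 1 - 2 * c * a + a\<^sup>2" and "Y = 1 + 2 * c * a + a\<^sup>2"
    have F1: "F (t/2) * X = 1 - c * a"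
      using F[of "t/2"] that by (simp add: c_def X_def)
    have F2: "F (t/2 + pi) * Y = 1 + c * a"
      using F[of "t/2 + pi"] that by (simp add: c_def Y_def)
    have XY: "1 - 2 * (2 * c\<^sup>2 - 1) * a\<^sup>2 + (a\<^sup>2)\<^sup>2 = X * Y"
      by (simp add: algebra_simps power2_eq_square X_def Y_def)
    have "2 * (G t * (X * Y)) = (F (t/2) + F (t/2 + pi)) * (X * Y)"
      by (simp only: mult.assoc[symmetric] twoG)
    also have "\<dots> = (F (t/2) * X) * Y + (F (t/2 + pi) * Y) * X"
      by (simp only: distrib_right mult.assoc mult.commute[of X Y])
    also have "\<dots> = (1 - c * a) * Y + (1 + c * a) * X" by (simp only: F1 F2)
    also have "\<dots> = 2 * (1 - (2 * c\<^sup>2 - 1) * a\<^sup>2)"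
      by (simp add: algebra_simps power2_eq_square X_def Y_def)
    finally have "2 * (G t * (1 - 2 * (2 * c\<^sup>2 - 1) * a\<^sup>2 + (a\<^sup>2)\<^sup>2)) = 2 * (1 - (2 * c\<^sup>2 - 1) * a\<^sup>2)"
      unfolding XY .
    then show "2 * (G t * (1 - 2 * of_real (cos t) * a\<^sup>2 + (a\<^sup>2)\<^sup>2)) = 2 * (1 - of_real (cos t) * a\<^sup>2)"
      unfolding c .
  qed
  have 2: "G 0 * (1 - a\<^sup>2) = 1"
  proof (rule double_cancel)
    have "2 * (G 0 * (1 - a\<^sup>2)) = (F 0 + F pi) * (1 - a\<^sup>2)"
      using twoG[of 0] by (simp only: mult.assoc[symmetric]) simp
    also have "\<dots> = (F 0 * (1 - a)) * (1 + a) + (F pi * (1 + a)) * (1 - a)"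
      by (simp add: algebra_simps power2_eq_square)
    finally show "2 * (G 0 * (1 - a\<^sup>2)) = 2 * 1" unfolding F0 Fpi by simp
  qed
  have 3: "G pi * (1 + a\<^sup>2) = 1"
  proof (rule double_cancel)
    have "cos (pi / 2 + pi) = 0" by (simp only: cos_periodic_pi) simp
    then have "F (pi/2) * (1 + a\<^sup>2) = 1" "F (pi/2 + pi) * (1 + a\<^sup>2) = 1"
      using F[of "pi/2"] F[of "pi/2 + pi"] by (simp_all only: cos_pi_half) simp_all
    moreover have "2 * (G pi * (1 + a\<^sup>2)) = (F (pi/2) + F (pi/2 + pi)) * (1 + a\<^sup>2)"
      by (simp only: mult.assoc[symmetric] twoG)
    ultimately show "2 * (G pi * (1 + a\<^sup>2)) = 2 * 1" by (simp only: distrib_right) simp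
  qed
  have 4: "norm (G s - G t) \<le> e"
    if st: "0 \<le> t" "t \<le> 2*pi" "0 \<le> s" "s \<le> 2*pi" "\<bar>s - t\<bar> < 2 * d" for s t
  proof -
    have "s / 2 - t / 2 = (s - t) / 2" by (simp add: diff_divide_distrib)
    then have d: "\<bar>s / 2 - t / 2\<bar> < d" using st by simp
    have "G s - G t = (1/2) *\<^sub>R ((F (s/2) - F (t/2)) + (F (s/2 + pi) - F (t/2 + pi)))"
      by (simp add: G_def algebra_simps)
    then have "norm (G s - G t) \<le> (1/2) * (norm (F (s/2) - F (t/2)) + norm (F (s/2 + pi) - F (t/2 + pi)))"
      using norm_triangle_ineq by simp
    also have "\<dots> \<le> (1/2) * (e + e)"
      using st d by (intro mult_left_mono add_mono Fe) auto
    finally show ?thesis by simp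
  qed
  show ?thesis unfolding resolvent_modulus_def using 1 2 3 4 by (intro exI[of _ G]) auto
qed

lemma resolvent_modulus_power:
  assumes "resolvent_modulus a d e"
  shows "resolvent_modulus (a ^ (2 ^ k)) (2 ^ k * d) e"
proof (induction k)
  case (Suc k)
  have "(a ^ 2 ^ k)\<^sup>2 = a ^ 2 ^ Suc k" by (simp add: power_mult[symmetric] mult.commute)
  with resolvent_modulus_square[OF Suc] show ?case by (simp add: mult.assoc)
qed (use assms in simp)

lemma resolvent_modulus_exists:
  fixes a :: "'u::{real_normed_algebra_1, comm_ring_1}"
  assumes unit: "\<And>t. 1 - 2 * of_real (cos t) * a + a\<^sup>2 dvd 1" and e: "e > 0"
  shows "\<exists>d>0. resolvent_modulus a d e"
proof -
  define Q where "Q t = 1 - 2 * of_real (cos t) * a + a\<^sup>2" for t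
  have "\<forall>t. \<exists>y. Q t * y = 1" using unit unfolding Q_def dvd_def by metis
  then obtain I where I: "\<And>t. Q t * I t = 1" by metis
  define F where "F t = (1 - of_real (cos t) * a) * I t" for t
  have "continuous_on {0..2*pi} Q" unfolding Q_def by (intro continuous_intros)
  then have "continuous_on {0..2*pi} I" by (rule continuous_on_inverse_section) (rule I)
  then have "continuous_on {0..2*pi} F" unfolding F_def by (intro continuous_intros)
  then have "uniformly_continuous_on {0..2*pi} F" by (rule compact_uniformly_continuous) simp
  then obtain d where d: "d > 0" "\<And>s t. s \<in> {0..2*pi} \<Longrightarrow> t \<in> {0..2*pi} \<Longrightarrow> dist s t < d \<Longrightarrow> dist (F s) (F t) < e"
    unfolding uniformly_continuous_on_def using e by (metis dist_commute)
  have 1: "F t * (1 - 2 * of_real (cos t) * a + a\<^sup>2) = 1 - of_real (cos t) * a" for t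
  proof -
    have "F t * Q t = (1 - of_real (cos t) * a) * (Q t * I t)" by (simp add: F_def algebra_simps)
    also have "\<dots> = 1 - of_real (cos t) * a" by (simp only: I mult_1_right)
    finally show ?thesis unfolding Q_def .
  qed
  have 2: "F 0 * (1 - a) = 1"
  proof -
    have "F 0 * (1 - a) = Q 0 * I 0" by (simp add: F_def Q_def algebra_simps power2_eq_square)
    then show ?thesis by (simp add: I)
  qed
  have 3: "F pi * (1 + a) = 1"
  proof -
    have "F pi * (1 + a) = Q pi * I pi" by (simp add: F_def Q_def algebra_simps power2_eq_square)
    then show ?thesis by (simp add: I)
  qed
  have "resolvent_modulus a d e" unfolding resolvent_modulus_def
    using 1 2 3 d(2) by (intro exI[of _ F]) (auto simp: dist_norm less_imp_le)
  with d show ?thesis by blast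
qed

text \<open>
  After enough squarings of \<open>a\<close> into \<open>b\<close>, the resolvent of \<open>b\<close> changes by at most \<open>e\<close> between 0 and
  \<open>\<pi>\<close>, while \<open>2 b = ((1 - b)\<^sup>-\<^sup>1 - (1 + b)\<^sup>-\<^sup>1) (1 - b\<^sup>2)\<close>. This is an elementary form of the spectral
  radius formula.
\<close>
lemma powers_small:
  fixes a :: "'u::{real_normed_algebra_1, comm_ring_1}"
  assumes unit: "\<And>t. 1 - 2 * of_real (cos t) * a + a\<^sup>2 dvd 1" and a: "norm a \<le> 1" and e: "e > 0"
  shows "\<exists>k. norm (a ^ (2 ^ k)) \<le> e"
proof -
  obtain d where d: "d > 0" "resolvent_modulus a d e"
    using resolvent_modulus_exists[OF unit e] by blast
  obtain k where "pi / d < 2 ^ k" using real_arch_pow[of 2 "pi / d"] by auto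
  then have k: "pi < 2 ^ k * d" using d by (simp add: field_simps)
  define b where "b = a ^ (2 ^ k)"
  have "norm b \<le> norm a ^ (2 ^ k)" unfolding b_def by (rule norm_power_ineq)
  also have "\<dots> \<le> 1" using a by (simp add: power_le_one)
  finally have b: "norm b \<le> 1" .
  from resolvent_modulus_power[OF d(2), of k] obtain F where
    F: "F 0 * (1 - b) = 1" "F pi * (1 + b) = 1"
    and Fe: "\<forall>s\<in>{0..2*pi}. \<forall>t\<in>{0..2*pi}. \<bar>s - t\<bar> < 2 ^ k * d \<longrightarrow> norm (F s - F t) \<le> e"
    unfolding resolvent_modulus_def b_def by auto
  have n: "norm (F 0 - F pi) \<le> e" using Fe k by simp
  have "(F 0 - F pi) * (1 - b\<^sup>2) = (F 0 * (1 - b)) * (1 + b) - (F pi * (1 + b)) * (1 - b)"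
    by (simp add: algebra_simps power2_eq_square)
  also have "\<dots> = 2 *\<^sub>R b" unfolding F scaleR_two by simp
  finally have eq: "(F 0 - F pi) * (1 - b\<^sup>2) = 2 *\<^sub>R b" .
  have "2 * norm b = norm ((F 0 - F pi) * (1 - b\<^sup>2))" unfolding eq by simp
  also have "\<dots> \<le> norm (F 0 - F pi) * norm (1 - b\<^sup>2)" by (rule norm_mult_ineq)
  also have "\<dots> \<le> e * 2"
  proof (intro mult_mono n)
    have "norm (b\<^sup>2) \<le> (norm b)\<^sup>2" by (rule norm_power_ineq)
    also have "\<dots> \<le> 1" using b by (simp add: power_le_one)
    finally show "norm (1 - b\<^sup>2) \<le> 2" using norm_triangle_ineq4[of 1 "b\<^sup>2"] by simp
  qed (use e in auto)
  finally have "norm b \<le> e" by simp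
  then show ?thesis unfolding b_def by auto
qed

lemma norm_emb: "norm (emb a) = norm a"
  by (simp add: norm_unital_def)

text \<open>
  The identity \<open>\<parallel>a\<^sup>2\<parallel> = \<parallel>a\<parallel>\<^sup>2\<close> of the class keeps the dyadic powers of an element of norm one at norm
  one, which is what the smallness of dyadic powers will contradict.
\<close>
lemma emb_power_norm:
  fixes a :: "'a::real_square_algebra"
  shows "\<exists>b. emb b = (emb a) ^ (2 ^ k) \<and> norm b = norm a ^ (2 ^ k)"
proof (induction k)
  case (Suc k)
  then obtain b where b: "emb b = (emb a) ^ (2 ^ k)" "norm b = norm a ^ (2 ^ k)" by blast
  have "emb (b * b) = (emb a) ^ (2 ^ Suc k)"
    unfolding emb_simps b by (simp add: power_add[symmetric] mult_2)
  moreover have "norm (b * b) = norm a ^ (2 ^ Suc k)"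
    unfolding norm_square b by (simp add: power_mult[symmetric] mult.commute)
  ultimately show ?case by blast
qed auto

text \<open>
  Normalise to \<open>\<parallel>v\<parallel> = 1\<close>. Off the real axis the factor \<open>1 - 2 cos t v + v\<^sup>2\<close> is a positive multiple of
  some \<open>1 + y\<^sup>2\<close>, hence invertible; if \<open>1 - v\<^sup>2\<close> were invertible too, the
  resolvent would exist on the whole unit circle and the dyadic powers of \<open>v\<close> would tend to zero.
\<close>
theorem norm_in_spectrum:
  fixes a :: "'a::real_square_algebra"
  assumes "a \<noteq> 0"
  shows "\<not> of_real ((norm a)\<^sup>2) - (emb a)\<^sup>2 dvd 1"
proof
  assume *: "of_real ((norm a)\<^sup>2) - (emb a)\<^sup>2 dvd 1"
  define u where "u = (1 / norm a) *\<^sub>R a"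
  define v where "v = emb u"
  have u: "norm u = 1" using assms by (simp add: u_def)
  have "of_real ((norm a)\<^sup>2) - (emb a)\<^sup>2 = (norm a)\<^sup>2 *\<^sub>R (1 - v\<^sup>2)"
    using assms by (simp add: v_def u_def unital_eq_iff power2_eq_square)
  then have "1 - v\<^sup>2 dvd 1"
    using * is_unit_scaleR[of "(norm a)\<^sup>2" "1 - v\<^sup>2"] assms by simp
  moreover have "1 - v\<^sup>2 = (1 - v) * (1 + v)" by (simp add: algebra_simps power2_eq_square)
  ultimately have "(1 - v) * (1 + v) dvd 1" by simp
  then have pm: "1 - v dvd 1" "1 + v dvd 1" by (rule dvd_mult_left, rule dvd_mult_right)
  have "1 - 2 * of_real (cos t) * v + v\<^sup>2 dvd 1" for t
  proof (cases "sin t = 0")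
    case False
    define y where "y = (1 / sin t) *\<^sub>R (v - of_real (cos t))"
    have "1 - 2 * of_real (cos t) * v + v\<^sup>2 = (sin t)\<^sup>2 *\<^sub>R (1 + y\<^sup>2)"
    proof -
      have "(sin t)\<^sup>2 *\<^sub>R y\<^sup>2 = (v - of_real (cos t))\<^sup>2"
        using False by (simp add: y_def power2_eq_square)
      moreover have "(sin t)\<^sup>2 *\<^sub>R 1 = (1 - (of_real (cos t))\<^sup>2 :: 'a unital)"
      proof -
        have "of_real ((sin t)\<^sup>2) = (of_real (1 - (cos t)\<^sup>2) :: 'a unital)" by (simp only: sin_squared_eq)
        then show ?thesis by (simp add: scaleR_conv_of_real)
      qed
      ultimately show ?thesis by (simp add: scaleR_right_distrib power2_eq_square algebra_simps)
    qed
    then show ?thesis using is_unit_one_plus_square[of y] is_unit_scaleR[of "(sin t)\<^sup>2" "1 + y\<^sup>2"] False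
      by simp
  next
    case True
    then have "cos t = 1 \<or> cos t = -1" using sin_cos_squared_add[of t] by (simp add: power2_eq_1_iff)
    then show ?thesis
    proof
      assume "cos t = 1"
      then have "1 - 2 * of_real (cos t) * v + v\<^sup>2 = (1 - v) * (1 - v)"
        by (simp add: algebra_simps power2_eq_square)
      then show ?thesis using pm mult_dvd_mono[of "1 - v" 1 "1 - v" 1] by simp
    next
      assume "cos t = -1"
      then have "1 - 2 * of_real (cos t) * v + v\<^sup>2 = (1 + v) * (1 + v)"
        by (simp add: algebra_simps power2_eq_square)
      then show ?thesis using pm mult_dvd_mono[of "1 + v" 1 "1 + v" 1] by simp
    qed
  qed
  moreover have "norm v \<le> 1" using u by (simp add: v_def norm_unital_def)
  ultimately obtain k where k: "norm (v ^ (2 ^ k)) \<le> 1 / 2"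
    using powers_small[of v "1/2"] by auto
  obtain b where "emb b = v ^ (2 ^ k)" "norm b = norm u ^ (2 ^ k)"
    using emb_power_norm unfolding v_def by blast
  then have "norm (v ^ (2 ^ k)) = 1" using u by (metis (no_types) norm_emb power_one)
  with k show False by simp
qed

section \<open>Sums of squares and real characters\<close>

text \<open>
  A root \<open>1 - u\<close> of \<open>1 - x\<close> is a fixed point of \<open>u \<mapsto> (x + u\<^sup>2)/2\<close>, which is a
  contraction of the ball of radius one half.
\<close>
lemma sqrt_near_one:
  fixes x :: "'u::{real_normed_algebra_1, comm_ring_1, banach}"
  assumes x: "norm x \<le> 3 / 4"
  shows "\<exists>v. v\<^sup>2 = 1 - x"
proof -
  define f where "f u = (1/2) *\<^sub>R (x + u * u)" for u
  have "\<exists>!u. u \<in> cball 0 (1/2) \<and> f u = u"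
  proof (rule Banach_fix[where c = "1/2"])
    show "f ` cball 0 (1 / 2) \<subseteq> cball 0 (1 / 2)"
    proof safe
      fix u :: 'u assume "u \<in> cball 0 (1/2)"
      then have u: "norm u \<le> 1 / 2" by simp
      have "norm (u * u) \<le> norm u * norm u" by (rule norm_mult_ineq)
      also have "\<dots> \<le> (1/2) * (1/2)" using u by (intro mult_mono) auto
      finally show "f u \<in> cball 0 (1/2)"
        using norm_triangle_ineq[of x "u * u"] x by (simp add: f_def)
    qed
    fix u v :: 'u assume "u \<in> cball 0 (1/2)" "v \<in> cball 0 (1/2)"
    then have uv: "norm u \<le> 1 / 2" "norm v \<le> 1 / 2" by auto
    have "f u - f v = (1/2) *\<^sub>R ((u + v) * (u - v))" by (simp add: f_def algebra_simps)
    then have "norm (f u - f v) \<le> (1/2) * (norm (u + v) * norm (u - v))"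
      using norm_mult_ineq by simp
    also have "\<dots> \<le> (1/2) * (1 * norm (u - v))"
      using uv norm_triangle_ineq[of u v] by (intro mult_left_mono mult_right_mono) auto
    finally show "dist (f u) (f v) \<le> (1/2) * dist u v" by (simp add: dist_norm)
  qed (auto simp: complete_eq_closed)
  then obtain u where "f u = u" by blast
  then have "2 *\<^sub>R f u = 2 *\<^sub>R u" by simp
  then have "x + u * u = 2 * u" by (simp add: f_def scaleR_two)
  then have "(1 - u)\<^sup>2 = 1 - x" by (simp add: power2_eq_square algebra_simps)
  then show ?thesis ..
qed

text \<open>
  Move from \<open>1\<close> to \<open>1 + y\<^sup>2\<close> along \<open>Q \<mu> = 1 + \<mu> y\<^sup>2\<close>. Every \<open>Q \<mu>\<close> is invertible and the inverses are
  bounded by compactness, so for a fine subdivision the quotient of successive values is close to 1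
  and hence a square. The norm of \<open>y\<close> may be arbitrarily large.
\<close>
lemma one_plus_square_is_square:
  fixes y :: "'a::real_square_algebra unital"
  shows "\<exists>v. v\<^sup>2 = 1 + y\<^sup>2"
proof -
  define Q where "Q \<mu> = 1 + \<mu> *\<^sub>R y\<^sup>2" for \<mu> :: real
  have "\<exists>z. Q \<mu> * z = 1" if "\<mu> \<in> {0..1}" for \<mu>
  proof -
    have "Q \<mu> = 1 + (sqrt \<mu> *\<^sub>R y)\<^sup>2" using that by (simp add: Q_def power2_eq_square)
    then have "Q \<mu> dvd 1" using is_unit_one_plus_square[of "sqrt \<mu> *\<^sub>R y"] by simp
    then obtain z where "1 = Q \<mu> * z" by (rule dvdE)
    from this[symmetric] show ?thesis by (rule exI)
  qed
  then obtain I where I: "\<And>\<mu>. \<mu> \<in> {0..1} \<Longrightarrow> Q \<mu> * I \<mu> = 1" by metis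
  have "continuous_on {0..1} Q" unfolding Q_def by (intro continuous_intros)
  then have "continuous_on {0..1} I" by (rule continuous_on_inverse_section) (rule I)
  then have "compact (I ` {0..1})" by (rule compact_continuous_image) simp
  then obtain B where B: "\<And>\<mu>. \<mu> \<in> {0..1} \<Longrightarrow> norm (I \<mu>) \<le> B"
    by (meson bounded_iff compact_imp_bounded imageI)
  obtain n :: nat where "norm (y\<^sup>2) * B * 2 < real n" using reals_Archimedean2 by blast
  moreover have "0 \<le> B" using B[of 0] norm_ge_zero[of "I 0"] by (simp del: norm_ge_zero)
  then have "0 \<le> norm (y\<^sup>2) * B" by simp
  ultimately have n: "n > 0" "norm (y\<^sup>2) * B / n \<le> 3 / 4"
    by (auto simp: divide_le_eq intro!: gr0I)
  have "\<exists>v. v\<^sup>2 = Q (k / n)" if "k \<le> n" for k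
    using that
  proof (induction k)
    case 0
    then show ?case by (intro exI[of _ 1]) (simp add: Q_def)
  next
    case (Suc k)
    then obtain v where v: "v\<^sup>2 = Q (k / n)" by auto
    have k: "k / n \<in> {0..1}" using Suc by (simp add: field_simps)
    have "norm (- ((1 / n) *\<^sub>R (y\<^sup>2 * I (k / n)))) \<le> norm (y\<^sup>2) * B / n"
    proof -
      have "norm (y\<^sup>2 * I (k / n)) \<le> norm (y\<^sup>2) * norm (I (k / n))" by (rule norm_mult_ineq)
      also have "\<dots> \<le> norm (y\<^sup>2) * B" by (intro mult_left_mono B k) simp
      finally show ?thesis by (simp add: divide_right_mono)
    qed
    also note n(2)
    finally obtain w where w: "w\<^sup>2 = 1 - (- ((1 / n) *\<^sub>R (y\<^sup>2 * I (k / n))))" using sqrt_near_one by blast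
    have "(v * w)\<^sup>2 = Q (k / n) * (1 + (1 / n) *\<^sub>R (y\<^sup>2 * I (k / n)))"
      unfolding power_mult_distrib v w by simp
    also have "\<dots> = Q (k / n) + (1 / n) *\<^sub>R (y\<^sup>2 * (Q (k / n) * I (k / n)))"
      by (simp only: distrib_left mult_1_right mult_scaleR_right mult.left_commute)
    also have "\<dots> = Q (Suc k / n)"
      unfolding I[OF k] by (simp add: Q_def add_divide_distrib scaleR_left_distrib)
    finally show ?case by blast
  qed
  from this[of n] show ?thesis using n by (simp add: Q_def)
qed

inductive_set sums_of_squares :: "'u::comm_ring_1 set" where
  zero: "0 \<in> sums_of_squares"
| add: "s \<in> sums_of_squares \<Longrightarrow> s + x\<^sup>2 \<in> sums_of_squares"

lemma sums_of_squares_square: "x\<^sup>2 \<in> sums_of_squares"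
  using sums_of_squares.add[OF sums_of_squares.zero, of x] by simp

lemma sums_of_squares_add:
  assumes "s \<in> sums_of_squares" "t \<in> sums_of_squares"
  shows "s + t \<in> sums_of_squares"
  using assms(2,1)
proof induction
  case (add t x)
  then show ?case using sums_of_squares.add[of "s + t" x] by (simp add: add.assoc)
qed simp

lemma sums_of_squares_mult:
  assumes "s \<in> sums_of_squares" "t \<in> sums_of_squares"
  shows "s * t \<in> sums_of_squares"
proof -
  have 1: "s * x\<^sup>2 \<in> sums_of_squares" for x
    using assms(1)
  proof induction
    case (add s y)
    then have "s * x\<^sup>2 + (y * x)\<^sup>2 \<in> sums_of_squares" by (intro sums_of_squares.add)
    then show ?case by (simp add: power_mult_distrib distrib_right)
  qed (simp add: sums_of_squares.zero)
  show ?thesis using assms(2)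
  proof induction
    case (add t x)
    then show ?case using sums_of_squares_add[OF _ 1] by (simp only: distrib_left)
  qed (simp add: sums_of_squares.zero)
qed

text \<open>
  The induction needs that \<open>1 + s\<close> is the square of an invertible \<open>v\<close>: then
  \<open>1 + s + x\<^sup>2 = v\<^sup>2 (1 + (x/v)\<^sup>2)\<close>, and the second factor is again such a square.
\<close>
lemma is_unit_one_plus_sum_of_squares:
  fixes s :: "'a::real_square_algebra unital"
  assumes "s \<in> sums_of_squares"
  shows "1 + s dvd 1"
proof -
  have "\<exists>v w. 1 + s = v\<^sup>2 \<and> v * w = 1"
    using assms
  proof induction
    case zero
    then show ?case by (intro exI[of _ 1]) simp
  next
    case (add s x)
    then obtain v w where vw: "1 + s = v\<^sup>2" "v * w = 1" by blast
    obtain u where u: "u\<^sup>2 = 1 + (x * w)\<^sup>2" using one_plus_square_is_square by blast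
    have "u * u dvd 1"
      using is_unit_one_plus_square[of "x * w"] unfolding u[symmetric] by (simp add: power2_eq_square)
    then have "u dvd 1" by (rule dvd_mult_left)
    then obtain u' where "1 = u * u'" by (rule dvdE)
    then have u': "u * u' = 1" by (rule sym)
    have "(v * u)\<^sup>2 = v\<^sup>2 + (x * (v * w))\<^sup>2"
    proof -
      have "(v * u)\<^sup>2 = v\<^sup>2 * (1 + (x * w)\<^sup>2)" by (simp only: power_mult_distrib u)
      also have "\<dots> = v\<^sup>2 + (x * (v * w))\<^sup>2" by (simp add: power2_eq_square algebra_simps)
      finally show ?thesis .
    qed
    then have "1 + (s + x\<^sup>2) = (v * u)\<^sup>2" unfolding vw(2) by (simp add: vw(1)[symmetric] add.assoc)
    moreover have "(v * u) * (w * u') = 1" 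
    proof -
      have "(v * u) * (w * u') = (v * w) * (u * u')" by (simp only: ac_simps)
      then show ?thesis using vw(2) u' by simp
    qed
    ultimately show ?case by blast
  qed
  then obtain v w where "1 + s = v\<^sup>2" "v * w = 1" by blast
  then have "(1 + s) * w\<^sup>2 = 1" by (simp flip: power_mult_distrib)
  then show ?thesis by (intro dvdI[OF sym])
qed

definition preordering :: "'u::comm_ring_1 set \<Rightarrow> bool"
  where "preordering T \<longleftrightarrow> (\<forall>x\<in>T. \<forall>y\<in>T. x + y \<in> T) \<and> (\<forall>x\<in>T. \<forall>y\<in>T. x * y \<in> T) \<and>
    (\<forall>x. x\<^sup>2 \<in> T) \<and> - 1 \<notin> T"

lemma preorderingD:
  assumes "preordering T"
  shows "x \<in> T \<Longrightarrow> y \<in> T \<Longrightarrow> x + y \<in> T" "x \<in> T \<Longrightarrow> y \<in> T \<Longrightarrow> x * y \<in> T" "x\<^sup>2 \<in> T" "- 1 \<notin> T"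
  using assms unfolding preordering_def by auto

text \<open>
  A maximal preordering \<open>T\<close> is total: if neither \<open>x\<close> nor \<open>-x\<close> could be adjoined, then
  \<open>- 1 = s + x t\<close> and \<open>- 1 = s' - x t'\<close>, and multiplying \<open>1 + s = - x t\<close> by \<open>1 + s' = x t'\<close> exhibits
  \<open>- 1\<close> as an element of \<open>T\<close>.
\<close>
lemma preordering_extend_total:
  assumes T0: "preordering T0"
  shows "\<exists>T. T0 \<subseteq> T \<and> preordering T \<and> (\<forall>x. x \<in> T \<or> - x \<in> T)"
proof -
  define A where "A = {T. T0 \<subseteq> T \<and> preordering T}"
  have "\<exists>M\<in>A. \<forall>X\<in>A. M \<subseteq> X \<longrightarrow> X = M"
  proof (rule subset_Zorn_nonempty)
    show "A \<noteq> {}" using T0 by (auto simp: A_def)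
  next
    fix C assume C: "C \<noteq> {}" "subset.chain A C"
    have CA: "\<And>X. X \<in> C \<Longrightarrow> T0 \<subseteq> X \<and> preordering X"
      using C(2) unfolding subset.chain_def A_def by blast
    have two: "\<exists>X\<in>C. x \<in> X \<and> y \<in> X" if xy: "x \<in> \<Union>C" "y \<in> \<Union>C" for x y
    proof -
      obtain X Y where "X \<in> C" "x \<in> X" "Y \<in> C" "y \<in> Y" using xy by blast
      moreover have "X \<subseteq> Y \<or> Y \<subseteq> X" using C(2) calculation unfolding subset_chain_def by blast
      ultimately show ?thesis by blast
    qed
    have "preordering (\<Union>C)" unfolding preordering_def
    proof (intro conjI ballI allI)
      fix x y assume "x \<in> \<Union>C" "y \<in> \<Union>C"
      then obtain X where X: "X \<in> C" "x \<in> X" "y \<in> X" using two by blast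
      then have "preordering X" using CA by blast
      from preorderingD(1,2)[OF this X(2,3)] show "x + y \<in> \<Union>C" "x * y \<in> \<Union>C" using X(1) by blast+
    next
      fix x
      obtain X where X: "X \<in> C" using C(1) by blast
      then have "preordering X" using CA by blast
      from preorderingD(3)[OF this] show "x\<^sup>2 \<in> \<Union>C" using X by blast
    next
      have "- 1 \<notin> X" if "X \<in> C" for X using CA[OF that] preorderingD(4)[of X] by blast
      then show "- 1 \<notin> \<Union>C" by blast
    qed
    then show "\<Union>C \<in> A" using C(1) CA unfolding A_def by blast
  qed
  then obtain T where TA: "T \<in> A" and TX: "\<forall>X\<in>A. T \<subseteq> X \<longrightarrow> X = T" by blast
  have T: "T0 \<subseteq> T" "preordering T" using TA by (simp_all add: A_def)
  have max: "X = T" if "preordering X" "T \<subseteq> X" for X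
    using TX that T(1) unfolding A_def by blast
  note T' = preorderingD[OF T(2)]
  have 01: "0 \<in> T" "1 \<in> T" using T'(3)[of 0] T'(3)[of 1] by auto
  have adjoin: "\<exists>s\<in>T. \<exists>t\<in>T. - 1 = s + a * t" if a: "a \<notin> T" for a
  proof (rule ccontr)
    assume no: "\<not> ?thesis"
    define X where "X = {s + a * t | s t. s \<in> T \<and> t \<in> T}"
    have XI: "z \<in> X" if "z = s + a * t" "s \<in> T" "t \<in> T" for z s t
      using that unfolding X_def by blast
    have "preordering X" unfolding preordering_def
    proof (intro conjI ballI allI)
      fix x y assume "x \<in> X" "y \<in> X"
      then obtain s t s' t' where st: "s \<in> T" "t \<in> T" "s' \<in> T" "t' \<in> T" "x = s + a * t" "y = s' + a * t'"
        unfolding X_def by blast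
      have "x + y = (s + s') + a * (t + t')" using st by (simp add: algebra_simps)
      then show "x + y \<in> X" by (rule XI) (intro T' st)+
      have "x * y = (s * s' + a\<^sup>2 * (t * t')) + a * (s * t' + t * s')"
        using st by (simp add: algebra_simps power2_eq_square)
      then show "x * y \<in> X" by (rule XI) (intro T' st)+
    next
      show "x\<^sup>2 \<in> X" for x by (rule XI[of _ "x\<^sup>2" 0]) (simp_all add: T' 01)
      show "- 1 \<notin> X" using no unfolding X_def by blast
    qed
    moreover have "T \<subseteq> X"
    proof
      fix x assume "x \<in> T"
      then show "x \<in> X" by (intro XI[of _ x 0]) (simp_all add: 01)
    qed
    ultimately have "X = T" by (rule max)
    moreover have "a \<in> X" by (rule XI[of _ 0 1]) (simp_all add: 01)
    ultimately show False using a by blast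
  qed
  have "x \<in> T \<or> - x \<in> T" for x
  proof (rule ccontr)
    assume "\<not> ?thesis"
    then obtain s t s' t' where st: "s \<in> T" "t \<in> T" "s' \<in> T" "t' \<in> T"
      and eq: "- 1 = s + x * t" "- 1 = s' + (- x) * t'"
      using adjoin[of x] adjoin[of "- x"] by blast
    have e: "1 + s = - (x * t)" "1 + s' = x * t'" 
    proof -
      have "s = - 1 - x * t" "s' = - 1 - (- x) * t'"
        by (simp only: eq(1) add_diff_cancel_right', simp only: eq(2) add_diff_cancel_right')
      then show "1 + s = - (x * t)" "1 + s' = x * t'" by simp_all
    qed
    have "(1 + s) * (1 + s') = - (x\<^sup>2 * (t * t'))" unfolding e by (simp add: algebra_simps power2_eq_square)
    moreover have "(1 + s) * (1 + s') = 1 + (s + s' + s * s')" by (simp add: algebra_simps)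
    ultimately have P: "1 + (s + s' + s * s') = - (x\<^sup>2 * (t * t'))" by simp
    have "- 1 = - 1 + (1 + (s + s' + s * s')) + x\<^sup>2 * (t * t')" unfolding P by simp
    also have "\<dots> = (s + s' + s * s') + x\<^sup>2 * (t * t')" by simp
    also have "\<dots> \<in> T" by (intro T' st)
    finally show False using T'(4) by contradiction
  qed
  with T show ?thesis by blast
qed

text \<open>
  In a total archimedean preordering every element \<open>x\<close> is infinitesimally near exactly one real number,
  the supremum of the reals below it; this number is the value of the character. Multiplicativity
  reduces by polarisation to squares, and there to \<open>c\<close> near 0, where
  \<open>0 \<le> c\<^sup>2 \<le> \<epsilon>\<close> follows from \<open>(\<surd>\<epsilon> - c) (\<surd>\<epsilon> + c) \<ge> 0\<close>. This is the classical representation theorem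
  of Kadison and Dubois for a single order.
\<close>
lemma total_preordering_character:
  fixes T :: "'u::{real_algebra_1, comm_ring_1} set"
  assumes T: "preordering T" and total: "\<And>x. x \<in> T \<or> - x \<in> T"
    and arch: "\<And>x. \<exists>r. of_real r - x \<in> T"
  shows "\<exists>\<gamma> :: 'u \<Rightarrow> real. (\<forall>x y. \<gamma> (x + y) = \<gamma> x + \<gamma> y) \<and> (\<forall>x y. \<gamma> (x * y) = \<gamma> x * \<gamma> y) \<and>
    (\<forall>r. \<gamma> (of_real r) = r) \<and> (\<forall>x\<in>T. \<gamma> x \<ge> 0)"
proof -
  note T' = preorderingD[OF T]
  have pos: "of_real r \<in> T" if "r \<ge> 0" for r
    using T'(3)[of "of_real (sqrt r)"] that by (simp add: of_real_power[symmetric] del: of_real_power)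
  have neg: "r \<ge> 0" if "of_real r \<in> T" for r
  proof (rule ccontr)
    assume "\<not> r \<ge> 0"
    then have "of_real (- (1 / r)) \<in> T" by (intro pos) (simp add: divide_nonpos_nonpos)
    then have "of_real (- (1 / r)) * of_real r \<in> T" using that by (rule T'(2))
    moreover have "of_real (- (1 / r)) * of_real r = (of_real (- (1 / r) * r) :: 'u)" by (simp only: of_real_mult)
    ultimately show False using T'(4) \<open>\<not> r \<ge> 0\<close> by simp
  qed
  define near where "near x r \<longleftrightarrow> (\<forall>\<epsilon>>0. x - of_real (r - \<epsilon>) \<in> T \<and> of_real (r + \<epsilon>) - x \<in> T)" for x and r :: real
  have nearI: "near x r" if "\<And>\<epsilon>. \<epsilon> > 0 \<Longrightarrow> x - of_real (r - \<epsilon>) \<in> T" "\<And>\<epsilon>. \<epsilon> > 0 \<Longrightarrow> of_real (r + \<epsilon>) - x \<in> T" for x r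
    using that unfolding near_def by blast
  have nearD: "x - of_real (r - \<epsilon>) \<in> T" "of_real (r + \<epsilon>) - x \<in> T" if "near x r" "\<epsilon> > 0" for x r \<epsilon>
    using that unfolding near_def by blast+
  have ex: "\<exists>r. near x r" for x
  proof -
    define L where "L = {r. x - of_real r \<in> T}"
    obtain r1 r2 where r12: "of_real r1 - x \<in> T" "of_real r2 - (- x) \<in> T" using arch by blast
    have ne: "- r2 \<in> L" using r12 by (simp add: L_def add.commute)
    have ub: "r \<le> r1" if "r \<in> L" for r
    proof -
      have "(x - of_real r) + (of_real r1 - x) \<in> T" using that r12 unfolding L_def by (intro T'(1)) auto
      then have "of_real (r1 - r) \<in> T" by simp
      then show ?thesis using neg[of "r1 - r"] by simp
    qed
    have bdd: "bdd_above L" using ub by (rule bdd_aboveI)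
    have down: "r' \<in> L" if "r \<in> L" "r' \<le> r" for r r'
    proof -
      have "(x - of_real r) + of_real (r - r') \<in> T" using that pos[of "r - r'"] unfolding L_def by (intro T'(1)) auto
      then show ?thesis by (simp add: L_def)
    qed
    have "near x (Sup L)"
    proof (rule nearI)
      fix \<epsilon> :: real assume \<epsilon>: "\<epsilon> > 0"
      then obtain r where "r \<in> L" "Sup L - \<epsilon> < r" using less_cSupD[of L "Sup L - \<epsilon>"] ne by auto
      then have "Sup L - \<epsilon> \<in> L" using down by force
      then show "x - of_real (Sup L - \<epsilon>) \<in> T" by (simp add: L_def)
      have "Sup L + \<epsilon> \<notin> L" using cSup_upper[OF _ bdd, of "Sup L + \<epsilon>"] \<epsilon> by linarith
      then show "of_real (Sup L + \<epsilon>) - x \<in> T" using total[of "x - of_real (Sup L + \<epsilon>)"] by (simp add: L_def)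
    qed
    then show ?thesis ..
  qed
  have uniq_le: "r \<le> r'" if "near x r" "near x r'" for x r r'
  proof (rule field_le_epsilon)
    fix e :: real assume "e > 0"
    then have "(x - of_real (r - e / 2)) + (of_real (r' + e / 2) - x) \<in> T"
      by (intro T'(1) nearD that) simp_all
    also have "(x - of_real (r - e / 2)) + (of_real (r' + e / 2) - x) = of_real (r' + e - r)"
      by (simp flip: of_real_add of_real_diff)
    finally show "r \<le> r' + e" using neg[of "r' + e - r"] by simp
  qed
  have near_add: "near (x + y) (r + s)" if "near x r" "near y s" for x y r s
  proof (rule nearI)
    fix e :: real assume "e > 0"
    then have e: "e / 2 > 0" by simp
    have "(x - of_real (r - e / 2)) + (y - of_real (s - e / 2)) \<in> T"
      by (intro T'(1) nearD[OF that(1) e] nearD[OF that(2) e])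
    also have "(x - of_real (r - e / 2)) + (y - of_real (s - e / 2))
        = x + y - (of_real (r - e / 2) + of_real (s - e / 2))" by simp
    also have "of_real (r - e / 2) + of_real (s - e / 2) = (of_real (r + s - e) :: 'u)"
      by (simp only: of_real_add[symmetric]) simp
    finally show "x + y - of_real (r + s - e) \<in> T" .
    have "(of_real (r + e / 2) - x) + (of_real (s + e / 2) - y) \<in> T"
      by (intro T'(1) nearD[OF that(1) e] nearD[OF that(2) e])
    also have "(of_real (r + e / 2) - x) + (of_real (s + e / 2) - y)
        = of_real (r + e / 2) + of_real (s + e / 2) - (x + y)" by simp
    also have "of_real (r + e / 2) + of_real (s + e / 2) = (of_real (r + s + e) :: 'u)"
      by (simp only: of_real_add[symmetric]) simp
    finally show "of_real (r + s + e) - (x + y) \<in> T" .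
  qed
  have near_real: "near (of_real r) r" for r
  proof (rule nearI)
    fix e :: real assume "e > 0"
    then have "of_real e \<in> T" using pos by simp
    then show "of_real r - of_real (r - e) \<in> T" "of_real (r + e) - of_real r \<in> T" by simp_all
  qed
  have near_minus: "near (- x) (- r)" if "near x r" for x r
  proof (rule nearI)
    fix e :: real assume "e > 0"
    from nearD[OF that this] show "- x - of_real (- r - e) \<in> T" "of_real (- r + e) - - x \<in> T"
      by (simp_all add: algebra_simps)
  qed
  have near_scale: "near (of_real s * x) (s * r)" if "near x r" for x r s
  proof -
    have pos_scale: "near (of_real s * x) (s * r)" if s: "s > 0" and x: "near x r" for s x r
    proof (rule nearI)
      fix e :: real assume "e > 0"
      then have e: "e / s > 0" using s by simp
      have sT: "of_real s \<in> T" using s pos by simp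
      have eq: "of_real s * of_real (e / s) = (of_real e :: 'u)" using s by (simp flip: of_real_mult)
      have "of_real s * (x - of_real (r - e / s)) \<in> T" by (intro T'(2) sT nearD[OF x e])
      then show "of_real s * x - of_real (s * r - e) \<in> T" using eq by (simp add: algebra_simps)
      have "of_real s * (of_real (r + e / s) - x) \<in> T" by (intro T'(2) sT nearD[OF x e])
      then show "of_real (s * r + e) - of_real s * x \<in> T" using eq by (simp add: algebra_simps)
    qed
    consider "s = 0" | "s > 0" | "s < 0" by linarith
    then show ?thesis
    proof cases
      case 1
      then show ?thesis using near_real[of 0] by simp
    next
      case 2
      then show ?thesis using pos_scale that by blast
    next
      case 3
      then show ?thesis using near_minus[OF pos_scale[OF _ that, of "- s"]] by simp
    qed
  qed
  have near_square: "near (x\<^sup>2) (r\<^sup>2)" if "near x r" for x r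
  proof -
    define c where "c = x - of_real r"
    have c: "near c 0" using near_add[OF that near_real[of "- r"]] by (simp add: c_def)
    have "near (c\<^sup>2) 0"
    proof (rule nearI)
      fix e :: real assume e: "e > 0"
      have "c\<^sup>2 + of_real e \<in> T" using T'(1)[OF T'(3) pos] e by simp
      then show "c\<^sup>2 - of_real (0 - e) \<in> T" by simp
      have se: "sqrt e > 0" using e by simp
      have "(of_real (0 + sqrt e) - c) * (c - of_real (0 - sqrt e)) \<in> T"
        by (intro T'(2) nearD[OF c se])
      also have "(of_real (0 + sqrt e) - c) * (c - of_real (0 - sqrt e)) = (of_real (sqrt e))\<^sup>2 - c\<^sup>2"
        by (simp add: algebra_simps power2_eq_square)
      also have "(of_real (sqrt e))\<^sup>2 = (of_real e :: 'u)" using e by (simp flip: of_real_power)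
      finally show "of_real (0 + e) - c\<^sup>2 \<in> T" by simp
    qed
    from near_add[OF near_add[OF this near_scale[OF that, of "2 * r"]] near_real[of "- r\<^sup>2"]]
    show ?thesis by (simp add: c_def algebra_simps power2_eq_square)
  qed
  have near_mult: "near (x * y) (r * s)" if "near x r" "near y s" for x y r s
  proof -
    have "near (of_real (1/4) * ((x + y)\<^sup>2 + - ((x + - y)\<^sup>2))) (1/4 * ((r + s)\<^sup>2 + - ((r + - s)\<^sup>2)))"
      by (intro near_scale near_add near_minus near_square that)
    also have "(x + y)\<^sup>2 + - ((x + - y)\<^sup>2) = 4 * (x * y)" by (simp add: algebra_simps power2_eq_square)
    also have "of_real (1/4) * (4 * (x * y)) = x * y"
    proof -
      have "of_real (1/4) * (4 * (x * y)) = of_real (1/4 * 4) * (x * y)" by (simp only: of_real_mult of_real_numeral mult.assoc)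
      then show ?thesis by simp
    qed
    also have "1/4 * ((r + s)\<^sup>2 + - ((r + - s)\<^sup>2)) = r * s" by (simp add: algebra_simps power2_eq_square)
    finally show ?thesis .
  qed
  obtain \<gamma> where \<gamma>: "\<And>x. near x (\<gamma> x)" using ex by metis
  have uniq: "\<gamma> x = r" if "near x r" for x r
    using uniq_le[OF \<gamma> that] uniq_le[OF that \<gamma>] by simp
  show ?thesis
  proof (intro exI[of _ \<gamma>] conjI allI ballI)
    show "\<gamma> (x + y) = \<gamma> x + \<gamma> y" "\<gamma> (x * y) = \<gamma> x * \<gamma> y" for x y
      by (intro uniq near_add near_mult \<gamma>)+
    show "\<gamma> (of_real r) = r" for r by (intro uniq near_real)
    fix x assume x: "x \<in> T"
    show "\<gamma> x \<ge> 0"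
    proof (rule field_le_epsilon)
      fix e :: real assume "e > 0"
      then have "x + (of_real (\<gamma> x + e) - x) \<in> T" by (intro T'(1) x nearD[OF \<gamma>])
      then show "0 \<le> \<gamma> x + e" using neg by simp
    qed
  qed
qed

definition character :: "('a::real_square_algebra \<Rightarrow> real) \<Rightarrow> bool"
  where "character \<gamma> \<longleftrightarrow> linear \<gamma> \<and> (\<forall>x y. \<gamma> (x * y) = \<gamma> x * \<gamma> y)"

lemma characterD:
  assumes "character \<gamma>"
  shows "\<gamma> (x + y) = \<gamma> x + \<gamma> y" "\<gamma> (x - y) = \<gamma> x - \<gamma> y" "\<gamma> (r *\<^sub>R x) = r * \<gamma> x" "\<gamma> 0 = 0"
    "\<gamma> (x * y) = \<gamma> x * \<gamma> y" "\<gamma> (- x) = - \<gamma> x"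
  using assms linear_add[of \<gamma>] linear_diff[of \<gamma>] linear_scale[of \<gamma>] linear_0[of \<gamma>] linear_neg[of \<gamma>]
  unfolding character_def by auto

text \<open>
  Adding the ideal generated by \<open>m = \<parallel>h\<parallel>\<^sup>2 - h\<^sup>2\<close> to the sums of squares gives a proper preordering:
  \<open>- 1 = s + m y\<close> would make \<open>m\<close> a divisor of the invertible element \<open>1 + s\<close>, but \<open>m\<close> is not
  invertible. A character that is nonnegative on \<open>m\<close> and on \<open>- m\<close> vanishes at \<open>m\<close>.
\<close>
theorem character_norm_attained:
  fixes h :: "'a::real_square_algebra"
  assumes "h \<noteq> 0"
  shows "\<exists>\<gamma>. character \<gamma> \<and> \<bar>\<gamma> h\<bar> = norm h"
proof -
  define m where "m = of_real ((norm h)\<^sup>2) - (emb h)\<^sup>2"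
  define T0 where "T0 = {s + m * y | s y. s \<in> sums_of_squares}"
  have "preordering T0" unfolding preordering_def
  proof (intro conjI ballI allI)
    fix x y assume "x \<in> T0" "y \<in> T0"
    then obtain s t s' t' where st: "s \<in> sums_of_squares" "s' \<in> sums_of_squares" "x = s + m * t" "y = s' + m * t'"
      unfolding T0_def by blast
    have "x + y = (s + s') + m * (t + t')" using st by (simp add: algebra_simps)
    then show "x + y \<in> T0" unfolding T0_def using sums_of_squares_add[OF st(1,2)] by blast
    have "x * y = s * s' + m * (s * t' + t * s' + m * t * t')"
      using st by (simp add: algebra_simps)
    then show "x * y \<in> T0" unfolding T0_def using sums_of_squares_mult[OF st(1,2)] by blast
  next
    fix x :: "'a unital"
    have "x\<^sup>2 = x\<^sup>2 + m * 0" by simp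
    then show "x\<^sup>2 \<in> T0" unfolding T0_def using sums_of_squares_square by blast
  next
    show "- 1 \<notin> T0"
    proof
      assume "- 1 \<in> T0"
      then obtain s y where s: "s \<in> sums_of_squares" "- 1 = s + m * y" unfolding T0_def by blast
      have "s = - 1 - m * y" by (simp only: s(2) add_diff_cancel_right')
      then have "m * (- y) = 1 + s" by simp
      then have "m dvd 1 + s" by (intro dvdI[OF sym])
      then have "m dvd 1" using is_unit_one_plus_sum_of_squares[OF s(1)] dvd_trans by blast
      then show False using norm_in_spectrum[OF assms] unfolding m_def by simp
    qed
  qed
  then obtain T where T: "T0 \<subseteq> T" "preordering T" and total: "\<And>x. x \<in> T \<or> - x \<in> T"
    using preordering_extend_total by metis
  have sq: "x\<^sup>2 \<in> T" for x using preorderingD(3)[OF T(2)] .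
  have m: "m \<in> T" "- m \<in> T"
  proof -
    have "m = 0 + m * 1" "- m = 0 + m * (- 1)" by simp_all
    then show "m \<in> T" "- m \<in> T" using T(1) sums_of_squares.zero unfolding T0_def by blast+
  qed
  have arch: "\<exists>r. of_real r - x \<in> T" for x :: "'a unital"
  proof -
    (* large enough for 1 - x / r to be a square, so that r - x is one too *)
    define r where "r = 2 * norm x + 1"
    have r: "r > 0" by (simp add: r_def add_nonneg_pos)
    have "norm ((1 / r) *\<^sub>R x) \<le> 3 / 4" using r by (simp add: r_def field_simps)
    then obtain v where v: "v\<^sup>2 = 1 - (1 / r) *\<^sub>R x" using sqrt_near_one by blast
    have "(sqrt r *\<^sub>R v)\<^sup>2 = r *\<^sub>R v\<^sup>2" using r by (simp add: power2_eq_square)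
    also have "\<dots> = of_real r - x" using r by (simp add: v scaleR_right_diff_distrib of_real_def)
    finally show ?thesis using sq by metis
  qed
  obtain \<gamma> :: "'a unital \<Rightarrow> real" where
    \<gamma>: "\<And>x y. \<gamma> (x + y) = \<gamma> x + \<gamma> y" "\<And>x y. \<gamma> (x * y) = \<gamma> x * \<gamma> y" "\<And>r. \<gamma> (of_real r) = r" "\<And>x. x \<in> T \<Longrightarrow> \<gamma> x \<ge> 0"
    using total_preordering_character[OF T(2) total arch] by blast
  have \<gamma>s: "\<gamma> (r *\<^sub>R x) = r * \<gamma> x" for r x using \<gamma>(2)[of "of_real r" x] \<gamma>(3) by (simp add: scaleR_conv_of_real)
  have \<gamma>m: "\<gamma> (- x) = - \<gamma> x" for x using \<gamma>s[of "- 1" x] by simp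
  have "character (\<lambda>a. \<gamma> (emb a))"
    unfolding character_def by (intro conjI linearI allI) (simp_all add: emb_simps \<gamma> \<gamma>s)
  moreover have "\<gamma> m = 0" using \<gamma>(4)[OF m(1)] \<gamma>(4)[OF m(2)] by (simp add: \<gamma>m)
  then have "(norm h)\<^sup>2 - (\<gamma> (emb h))\<^sup>2 = 0"
    using \<gamma>(1)[of "of_real ((norm h)\<^sup>2)" "- (emb h)\<^sup>2"] unfolding m_def
    by (simp add: \<gamma>m \<gamma>(2,3) power2_eq_square del: of_real_power of_real_mult)
  then have "\<bar>\<gamma> (emb h)\<bar> = norm h" using abs_le_square_iff[of "\<gamma> (emb h)" "norm h"] abs_le_square_iff[of "norm h" "\<gamma> (emb h)"] by simp
  ultimately show ?thesis by blast
qed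

text \<open>
  If \<open>\<gamma> b = 1\<close> with \<open>\<parallel>b\<parallel> < 1\<close>, then the solution of \<open>c = b + b c\<close> would give \<open>\<gamma> c = 1 + \<gamma> c\<close>.
\<close>
lemma character_le_norm:
  assumes "character \<gamma>"
  shows "\<bar>\<gamma> a\<bar> \<le> norm a"
proof (rule ccontr)
  note ch = characterD[OF assms]
  assume "\<not> ?thesis"
  then have a: "norm a < \<bar>\<gamma> a\<bar>" by simp
  then have nz: "\<gamma> a \<noteq> 0" by (metis abs_zero norm_ge_zero not_less)
  define b where "b = (1 / \<gamma> a) *\<^sub>R a"
  have b: "norm b < 1" "\<gamma> b = 1" using a nz by (simp_all add: b_def ch field_simps)
  have "\<exists>!c. b + b * c = c"
  proof (rule banach_fix_type[of "norm b"])
    show "\<forall>x y. dist (b + b * x) (b + b * y) \<le> norm b * dist x y"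
      using norm_mult_ineq[of b "_ - _"] by (simp add: dist_norm algebra_simps)
  qed (use b in auto)
  then obtain c where "b + b * c = c" by blast
  then have "\<gamma> (b + b * c) = \<gamma> c" by simp
  then show False using b by (simp add: ch)
qed

section \<open>Continuous functional calculus\<close>
lemma norm_le_of_characters:
  assumes "\<And>\<gamma>. character \<gamma> \<Longrightarrow> \<bar>\<gamma> a\<bar> \<le> c" "c \<ge> 0"
  shows "norm a \<le> c"
proof (cases "a = 0")
  case False
  then obtain \<gamma> where "character \<gamma>" "\<bar>\<gamma> a\<bar> = norm a" using character_norm_attained by blast
  then show ?thesis using assms(1)[of \<gamma>] by simp
qed (use assms in simp)

text \<open>
  Subtracting \<open>p 0\<close> keeps the result in the algebra, which may lack a unit.
\<close>
lemma polynomial_calculus: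
  assumes "real_polynomial_function p"
  shows "\<exists>b. \<forall>\<gamma>. character \<gamma> \<longrightarrow> \<gamma> b = p (\<gamma> a) - p (0::real)"
  using assms
proof induction
  case (linear f)
  have "f x = f 1 * x" for x using linear_scale[OF bounded_linear.linear[OF linear], of x 1] by simp
  then show ?case
    by (intro exI[of _ "f 1 *\<^sub>R a"] allI impI) (metis characterD(3) mult_zero_right diff_zero)
next
  case (const c)
  show ?case by (intro exI[of _ 0]) (auto simp: characterD)
next
  case (add f g)
  then obtain b c where "\<forall>\<gamma>. character \<gamma> \<longrightarrow> \<gamma> b = f (\<gamma> a) - f 0" "\<forall>\<gamma>. character \<gamma> \<longrightarrow> \<gamma> c = g (\<gamma> a) - g 0"
    by blast
  then show ?case by (intro exI[of _ "b + c"]) (auto simp: characterD)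
next
  case (mult f g)
  then obtain b c where bc: "\<forall>\<gamma>. character \<gamma> \<longrightarrow> \<gamma> b = f (\<gamma> a) - f 0" "\<forall>\<gamma>. character \<gamma> \<longrightarrow> \<gamma> c = g (\<gamma> a) - g 0"
    by blast
  have "\<gamma> (b * c + f 0 *\<^sub>R c + g 0 *\<^sub>R b) = f (\<gamma> a) * g (\<gamma> a) - f 0 * g 0"
    if "character \<gamma>" for \<gamma>
  proof -
    have "\<gamma> b = f (\<gamma> a) - f 0" "\<gamma> c = g (\<gamma> a) - g 0" using bc that by blast+
    then show ?thesis by (simp only: characterD[OF that]) (simp add: algebra_simps)
  qed
  then show ?case by blast
qed

text \<open>
  Weierstrass approximation on \<open>[-\<parallel>a\<parallel>, \<parallel>a\<parallel>]\<close>, an interval that contains the values of all characters at \<open>a\<close>. Since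
  characters determine the norm, uniform convergence of polynomials is convergence in the
  algebra.
\<close>
lemma continuous_calculus_characters:
  fixes a :: "'a::real_square_algebra"
  assumes f: "continuous_on UNIV f" "f 0 = 0"
  shows "\<exists>b. \<forall>\<gamma>. character \<gamma> \<longrightarrow> \<gamma> b = f (\<gamma> a)"
proof -
  define R where "R = norm a"
  have approx: "\<exists>b. \<forall>\<gamma>. character \<gamma> \<longrightarrow> \<bar>\<gamma> b - f (\<gamma> a)\<bar> \<le> 2 * e" if "e > 0" for e
  proof -
    have fR: "continuous_on {-R..R} f" using f(1) by (rule continuous_on_subset) simp
    obtain p where p: "real_polynomial_function p" "\<And>x. x \<in> {-R..R} \<Longrightarrow> \<bar>f x - p x\<bar> < e"
      using Stone_Weierstrass_real_polynomial_function[OF compact_Icc fR \<open>e > 0\<close>] by metis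
    obtain b where b: "\<forall>\<gamma>. character \<gamma> \<longrightarrow> \<gamma> b = p (\<gamma> a) - p 0" using polynomial_calculus[OF p(1)] by blast
    have "\<bar>\<gamma> b - f (\<gamma> a)\<bar> \<le> 2 * e" if "character \<gamma>" for \<gamma>
    proof -
      have "\<gamma> a \<in> {-R..R}" using character_le_norm[OF that, of a] by (auto simp: R_def abs_le_iff)
      moreover have "\<bar>p 0\<bar> < e" using p(2)[of 0] f(2) by (simp add: R_def)
      moreover have "\<gamma> b = p (\<gamma> a) - p 0" using b that by blast
      ultimately show ?thesis using p(2)[of "\<gamma> a"] by linarith
    qed
    then show ?thesis by blast
  qed
  have "\<exists>b. \<forall>\<gamma>. character \<gamma> \<longrightarrow> \<bar>\<gamma> b - f (\<gamma> a)\<bar> \<le> 2 / real (Suc n)" for n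
    using approx[of "1 / real (Suc n)"] by simp
  then obtain b where b: "\<And>n \<gamma>. character \<gamma> \<Longrightarrow> \<bar>\<gamma> (b n) - f (\<gamma> a)\<bar> \<le> 2 / real (Suc n)" by metis
  have diff: "norm (b m - b n) \<le> 2 / real (Suc m) + 2 / real (Suc n)" for m n
  proof (rule norm_le_of_characters)
    fix \<gamma> :: "'a \<Rightarrow> real" assume \<gamma>: "character \<gamma>"
    show "\<bar>\<gamma> (b m - b n)\<bar> \<le> 2 / real (Suc m) + 2 / real (Suc n)"
      using b[OF \<gamma>, of m] b[OF \<gamma>, of n] unfolding characterD(2)[OF \<gamma>] by linarith
  qed simp
  have "Cauchy b"
  proof (rule metric_CauchyI)
    fix e :: real assume e: "e > 0"
    then obtain N :: nat where N: "4 / e < real N" using reals_Archimedean2 by blast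
    have "dist (b m) (b n) < e" if "m \<ge> N" "n \<ge> N" for m n
    proof -
      have *: "2 / real (Suc k) < e / 2" if "k \<ge> N" for k
      proof -
        have "4 < e * real N" using N e by (simp add: field_simps)
        also have "\<dots> \<le> e * real (Suc k)" using that e by (intro mult_left_mono) auto
        finally show ?thesis by (simp add: field_simps)
      qed
      show ?thesis using diff[of m n] *[OF that(1)] *[OF that(2)] by (simp add: dist_norm)
    qed
    then show "\<exists>N. \<forall>m\<ge>N. \<forall>n\<ge>N. dist (b m) (b n) < e" by blast
  qed
  then obtain l where l: "b \<longlonglongrightarrow> l" by (auto simp: Cauchy_convergent_iff convergent_def)
  have "\<gamma> l = f (\<gamma> a)" if \<gamma>: "character \<gamma>" for \<gamma>
  proof (rule LIMSEQ_unique)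
    have "(\<lambda>n. norm (b n - l)) \<longlonglongrightarrow> 0" using l by (intro tendsto_norm_zero LIM_zero)
    then have "(\<lambda>n. \<gamma> (b n) - \<gamma> l) \<longlonglongrightarrow> 0"
    proof (rule Lim_null_comparison[rotated], intro always_eventually allI)
      show "norm (\<gamma> (b n) - \<gamma> l) \<le> norm (b n - l)" for n
        using character_le_norm[OF \<gamma>, of "b n - l"] by (simp add: characterD[OF \<gamma>])
    qed
    then show "(\<lambda>n. \<gamma> (b n)) \<longlonglongrightarrow> \<gamma> l" by (rule LIM_zero_cancel)
    have "(\<lambda>n. 2 * (1 / real (Suc n))) \<longlonglongrightarrow> 2 * 0" by (intro tendsto_intros LIMSEQ_Suc lim_1_over_n)
    then have "(\<lambda>n. 2 / real (Suc n)) \<longlonglongrightarrow> 0" by simp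
    then have "(\<lambda>n. \<gamma> (b n) - f (\<gamma> a)) \<longlonglongrightarrow> 0"
      by (rule Lim_null_comparison[rotated]) (use b[OF \<gamma>] in simp)
    then show "(\<lambda>n. \<gamma> (b n)) \<longlonglongrightarrow> f (\<gamma> a)" by (rule LIM_zero_cancel)
  qed
  then show ?thesis by blast
qed

section \<open>Gelfand theory of commutative real C*-algebras\<close>
lemma star_simps [simp]:
  fixes a b :: "'a::{real_cstar_algebra, comm_ring}"
  shows "star 0 = (0::'a)" "star (- a) = - star a" "star (a - b) = star a - star b"
    "star (a + b) = star a + star b" "star (a * b) = star a * star b"
    "star (r *\<^sub>R a) = r *\<^sub>R star a" "star (star a) = a"
proof -
  show 0: "star 0 = (0::'a)" using star_scaleR[of 0 "0::'a"] by simp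
  show m: "star (- a) = - star a" for a :: 'a using star_scaleR[of "- 1" a] by simp
  show "star (a - b) = star a - star b" using star_add[of a "- b"] m by simp
qed (simp_all add: star_add star_mult star_scaleR star_star mult.commute)

lemma norm_star [simp]:
  fixes a :: "'a::{real_cstar_algebra, comm_ring}"
  shows "norm (star a) = norm a"
proof -
  have le: "norm a \<le> norm (star a)" for a :: 'a
  proof (cases "a = 0")
    case False
    have "norm a * norm a \<le> norm (star a) * norm a"
      using norm_mult_ineq[of "star a" a] norm_star_mult_self[of a] by (simp add: power2_eq_square)
    then show ?thesis using False by simp
  qed simp
  show ?thesis using le[of a] le[of "star a"] by simp
qed

text \<open>
  The inverse in the unitization has the form \<open>1 + b\<close>. The equation for \<open>b\<close> is affine and its
  coefficients are self-adjoint, so the self-adjoint part of \<open>b\<close> solves it too.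
\<close>
lemma one_plus_star_mult_self_quasi_inverse:
  fixes x :: "'a::{real_cstar_algebra, comm_ring}"
  shows "\<exists>c. star c = c \<and> star x * x + c + star x * x * c = 0"
proof -
  define s where "s = star x * x"
  have s: "star s = s" by (simp add: s_def mult.commute)
  obtain y where y: "unitization_mult (star x * x, 1) y = unitization_one"
    using invertible_one_plus_star_mult_self[of x] unfolding unitization_invertible_def by blast
  define b where "b = fst y"
  have b: "s + b + s * b = 0" using y
    by (auto simp: unitization_mult_def unitization_one_def b_def s_def algebra_simps)
  then have "star (s + b + s * b) = 0" by simp
  then have b': "s + star b + s * star b = 0" by (simp add: s)
  define c where "c = (1/2) *\<^sub>R (b + star b)"
  have "s + c + s * c = (1/2) *\<^sub>R ((s + b + s * b) + (s + star b + s * star b))"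
    by (simp add: c_def algebra_simps flip: scaleR_add_left)
  then have "s + c + s * c = 0" unfolding b b' by simp
  moreover have "star c = c" by (simp add: c_def add.commute)
  ultimately show ?thesis unfolding s_def by blast
qed

typedef (overloaded) ('a::"{real_cstar_algebra, comm_ring}") selfadjoint = "{a :: 'a. star a = a}"
  morphisms sa_val Sa
  by (rule exI[of _ 0]) simp

setup_lifting type_definition_selfadjoint

lemma star_sa_val [simp]: "star (sa_val h) = sa_val h"
  using sa_val[of h] by simp

instantiation selfadjoint :: ("{real_cstar_algebra, comm_ring}") "{comm_ring, real_algebra}"
begin
lift_definition zero_selfadjoint :: "'a selfadjoint" is 0 by simp
lift_definition plus_selfadjoint :: "'a selfadjoint \<Rightarrow> 'a selfadjoint \<Rightarrow> 'a selfadjoint" is "(+)" by simp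
lift_definition uminus_selfadjoint :: "'a selfadjoint \<Rightarrow> 'a selfadjoint" is uminus by simp
lift_definition minus_selfadjoint :: "'a selfadjoint \<Rightarrow> 'a selfadjoint \<Rightarrow> 'a selfadjoint" is "(-)" by simp
lift_definition times_selfadjoint :: "'a selfadjoint \<Rightarrow> 'a selfadjoint \<Rightarrow> 'a selfadjoint" is "(*)" by simp
lift_definition scaleR_selfadjoint :: "real \<Rightarrow> 'a selfadjoint \<Rightarrow> 'a selfadjoint" is scaleR by simp
instance by standard (transfer, simp add: algebra_simps)+
end

instantiation selfadjoint :: ("{real_cstar_algebra, comm_ring}") real_normed_algebra
begin
lift_definition norm_selfadjoint :: "'a selfadjoint \<Rightarrow> real" is norm .
definition "sgn x = inverse (norm x) *\<^sub>R (x :: 'a selfadjoint)"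
definition "dist x y = norm (x - y :: 'a selfadjoint)"
definition uniformity_selfadjoint :: "('a selfadjoint \<times> 'a selfadjoint) filter"
  where "uniformity_selfadjoint = (INF e\<in>{0 <..}. principal {(x, y). dist x y < e})"
definition open_selfadjoint :: "'a selfadjoint set \<Rightarrow> bool"
  where "open_selfadjoint U \<longleftrightarrow> (\<forall>x\<in>U. eventually (\<lambda>(x', y). x' = x \<longrightarrow> y \<in> U) uniformity)"
instance
proof
  fix x y :: "'a selfadjoint" and r :: real
  show "(norm x = 0) = (x = 0)" by transfer simp
  show "norm (x + y) \<le> norm x + norm y" by transfer (rule norm_triangle_ineq)
  show "norm (r *\<^sub>R x) = \<bar>r\<bar> * norm x" by transfer simp
  show "norm (x * y) \<le> norm x * norm y" by transfer (rule norm_mult_ineq)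
qed (rule sgn_selfadjoint_def dist_selfadjoint_def uniformity_selfadjoint_def open_selfadjoint_def)+
end

instance selfadjoint :: ("{real_cstar_algebra, comm_ring}") banach
proof
  fix X :: "nat \<Rightarrow> 'a selfadjoint"
  assume "Cauchy X"
  then have "Cauchy (\<lambda>n. sa_val (X n))"
    unfolding Cauchy_iff norm_selfadjoint.rep_eq minus_selfadjoint.rep_eq .
  then obtain a where a: "(\<lambda>n. sa_val (X n)) \<longlonglongrightarrow> a"
    by (auto simp: Cauchy_convergent_iff convergent_def)
  have "bounded_linear (star :: 'a \<Rightarrow> 'a)"
    by (rule bounded_linear_intro[of _ 1]) (simp_all)
  from bounded_linear.tendsto[OF this a] have "(\<lambda>n. sa_val (X n)) \<longlonglongrightarrow> star a" by simp
  then have "star a = a" using a LIMSEQ_unique by blast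
  then have a': "sa_val (Sa a) = a" by (simp add: Sa_inverse)
  have "X \<longlonglongrightarrow> Sa a"
    using a unfolding tendsto_iff dist_norm norm_selfadjoint.rep_eq minus_selfadjoint.rep_eq a' .
  then show "convergent X" by (auto simp: convergent_def)
qed

instance selfadjoint :: ("{real_cstar_algebra, comm_ring}") real_square_algebra
proof
  fix a :: "'a selfadjoint"
  show "norm (a * a) = (norm a)\<^sup>2"
    using norm_star_mult_self[of "sa_val a"] by (simp add: norm_selfadjoint.rep_eq times_selfadjoint.rep_eq)
  obtain c where c: "star c = c" "sa_val a * sa_val a + c + sa_val a * sa_val a * c = 0"
    using one_plus_star_mult_self_quasi_inverse[of "sa_val a"] by auto
  have "a * a + Sa c + a * a * Sa c = 0"
    using c by (simp add: sa_val_inject[symmetric] plus_selfadjoint.rep_eq times_selfadjoint.rep_eq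
        zero_selfadjoint.rep_eq Sa_inverse)
  then show "\<exists>b. a * a + b + a * a * b = 0" by blast
qed

text \<open>
  A point is a *-homomorphism to the complex numbers that is linear over the reals only; a point and its complex
  conjugate are both points.
\<close>
definition gelfand_point :: "('a::{real_cstar_algebra, comm_ring} \<Rightarrow> complex) \<Rightarrow> bool"
  where "gelfand_point z \<longleftrightarrow> linear z \<and> (\<forall>x y. z (x * y) = z x * z y) \<and> (\<forall>x. z (star x) = cnj (z x))"

lemma gelfand_pointD:
  assumes "gelfand_point z"
  shows "z (x + y) = z x + z y" "z (x - y) = z x - z y" "z (r *\<^sub>R x) = of_real r * z x" "z 0 = 0"
    "z (x * y) = z x * z y" "z (star x) = cnj (z x)" "z (- x) = - z x" "z (sum f A) = (\<Sum>i\<in>A. z (f i))"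
  using assms linear_add[of z] linear_diff[of z] linear_scale[of z] linear_0[of z] linear_neg[of z] linear_sum[of z]
  unfolding gelfand_point_def by (auto simp: scaleR_conv_of_real)

lemma gelfand_point_selfadjoint:
  assumes "gelfand_point z" "star h = h"
  shows "z h = of_real (Re (z h))"
  using gelfand_pointD(6)[OF assms(1), of h] assms(2) by (simp add: complex_eq_iff)

lemma gelfand_point_skew:
  assumes "gelfand_point z" "star h = - h"
  shows "Re (z h) = 0"
  using gelfand_pointD(6,7)[OF assms(1), of h] assms(2) by (simp add: complex_eq_iff)

lemma character_of_gelfand_point:
  assumes "gelfand_point z"
  shows "character (\<lambda>h. Re (z (sa_val h)))"
proof -
  note z = gelfand_pointD[OF assms]
  have "Im (z (sa_val h)) = 0" for h
    using gelfand_point_selfadjoint[OF assms, of "sa_val h"] by (simp add: complex_eq_iff)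
  then show ?thesis unfolding character_def
    by (auto intro!: linearI simp: z plus_selfadjoint.rep_eq scaleR_selfadjoint.rep_eq times_selfadjoint.rep_eq)
qed

text \<open>
  On skew elements the point must be \<open>i \<xi>\<close> with \<open>\<gamma> (b d) = - \<xi> b \<xi> d\<close>. The form \<open>\<gamma> (b d)\<close> has rank at most one because
  \<open>\<gamma> (b d)\<^sup>2 = \<gamma> (b\<^sup>2) \<gamma> (d\<^sup>2)\<close>: if some skew \<open>e\<close> has \<open>\<gamma> (e\<^sup>2) \<noteq> 0\<close>, then \<open>\<xi>\<close> is a multiple of
  \<open>b \<mapsto> \<gamma> (b e)\<close>, and otherwise \<open>\<xi> = 0\<close>. The multiple is real since \<open>\<gamma> (e\<^sup>* e) \<ge> 0\<close>; this positivity
  is what invertibility of \<open>1 + x\<^sup>* x\<close> gives for \<open>x\<close> that are not self-adjoint.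
\<close>
lemma gelfand_point_of_character:
  fixes \<gamma> :: "'a::{real_cstar_algebra, comm_ring} selfadjoint \<Rightarrow> real"
  assumes "character \<gamma>"
  shows "\<exists>z. gelfand_point z \<and> (\<forall>h. z (sa_val h) = of_real (\<gamma> h))"
proof -
  define X where "X a = \<gamma> (Sa a)" for a
  have Xval: "X (sa_val h) = \<gamma> h" for h by (simp add: X_def sa_val_inverse)
  have X_add: "X (a + b) = X a + X b" and X_mult: "X (a * b) = X a * X b" and X_scale': "X (r *\<^sub>R a) = r * X a"
    if "star a = a" "star b = b" for a b r
  proof -
    from that obtain h k where hk: "a = sa_val h" "b = sa_val k" by (metis (mono_tags) Sa_inverse mem_Collect_eq)
    show "X (a + b) = X a + X b" "X (a * b) = X a * X b" "X (r *\<^sub>R a) = r * X a"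
      unfolding hk
      by (simp_all only: Xval plus_selfadjoint.rep_eq[symmetric] times_selfadjoint.rep_eq[symmetric]
          scaleR_selfadjoint.rep_eq[symmetric] characterD[OF assms])
  qed
  have X_scale: "X (r *\<^sub>R a) = r * X a" if "star a = a" for a r by (rule X_scale'[OF that that])
  have X_minus: "X (- a) = - X a" if "star a = a" for a using X_scale[OF that, of "- 1"] by simp
  have X_pos: "X (star x * x) \<ge> 0" for x
  proof (rule ccontr)
    assume "\<not> ?thesis"
    then have neg: "X (star x * x) < 0" by simp
    define r where "r = 1 / sqrt (- X (star x * x))"
    have r: "r * r * X (star x * x) = - 1" using neg by (simp add: r_def real_sqrt_mult[symmetric] del: real_sqrt_mult)
    obtain c where c: "star c = c" "star (r *\<^sub>R x) * (r *\<^sub>R x) + c + star (r *\<^sub>R x) * (r *\<^sub>R x) * c = 0"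
      using one_plus_star_mult_self_quasi_inverse by blast
    define s where "s = (r * r) *\<^sub>R (star x * x)"
    have s: "star s = s" by (simp add: s_def mult.commute)
    have Xs: "X s = - 1" using X_scale[of "star x * x" "r * r"] r by (simp add: s_def mult.commute)
    have "s + c + s * c = 0" using c by (simp add: s_def)
    then have "X (s + c + s * c) = X 0" by simp
    moreover have "X 0 = 0" using X_scale[of 0 0] by simp
    ultimately show False using s c(1) Xs by (simp add: X_add X_mult)
  qed
  define re sk where "re x = (1/2) *\<^sub>R (x + star x)" and "sk x = (1/2) *\<^sub>R (x - star x)" for x :: 'a
  have re: "star (re x) = re x" and sk: "star (sk x) = - sk x" and dec: "x = re x + sk x" for x
    by (simp_all add: re_def sk_def algebra_simps flip: scaleR_add_left)
  have "\<exists>\<xi>. (\<forall>b d. star b = - b \<longrightarrow> star d = - d \<longrightarrow> \<xi> (b + d) = \<xi> b + \<xi> d \<and> - (\<xi> b * \<xi> d) = X (b * d)) \<and>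
      (\<forall>b r. star b = - b \<longrightarrow> \<xi> (r *\<^sub>R b) = r * \<xi> b) \<and> (\<forall>a b. star a = a \<longrightarrow> star b = - b \<longrightarrow> \<xi> (a * b) = X a * \<xi> b)"
  proof (cases "\<exists>e. star e = - e \<and> X (e * e) \<noteq> 0")
    case True
    then obtain e where e: "star e = - e" "X (e * e) \<noteq> 0" by blast
    have ee: "X (e * e) < 0" using X_pos[of e] e X_minus[of "e * e"] by simp
    define k where "k = 1 / sqrt (- X (e * e))"
    have k: "k * k * X (e * e) = - 1" using ee by (simp add: k_def real_sqrt_mult[symmetric] del: real_sqrt_mult)
    show ?thesis
    proof (rule exI[of _ "\<lambda>b. k * X (b * e)"], intro conjI allI impI)
      fix b d :: 'a assume bd: "star b = - b" "star d = - d"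
      show "k * X ((b + d) * e) = k * X (b * e) + k * X (d * e)"
        using bd e by (simp add: distrib_right X_add algebra_simps)
      have "X (b * e) * X (d * e) = X (b * d) * X (e * e)"
      proof -
        have "X (b * e) * X (d * e) = X ((b * e) * (d * e))" using bd e by (intro X_mult[symmetric]) auto
        also have "(b * e) * (d * e) = (b * d) * (e * e)" by (simp only: ac_simps)
        also have "X \<dots> = X (b * d) * X (e * e)" using bd e by (intro X_mult) auto
        finally show ?thesis .
      qed
      then have "(k * X (b * e)) * (k * X (d * e)) = (k * k * X (e * e)) * X (b * d)" by (simp only: ac_simps)
      then show "- ((k * X (b * e)) * (k * X (d * e))) = X (b * d)" unfolding k by simp
    next
      fix b :: 'a and r :: real assume "star b = - b"
      then show "k * X (r *\<^sub>R b * e) = r * (k * X (b * e))" using e by (simp add: X_scale)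
    next
      fix a b :: 'a assume "star a = a" "star b = - b"
      then show "k * X (a * b * e) = X a * (k * X (b * e))" using e by (simp add: mult.assoc X_mult)
    qed
  next
    case False
    have "X (b * d) = 0" if bd: "star b = - b" "star d = - d" for b d
    proof -
      have "X (b * d) * X (b * d) = X ((b * d) * (b * d))" using bd by (intro X_mult[symmetric]) auto
      also have "(b * d) * (b * d) = (b * b) * (d * d)" by (simp only: ac_simps)
      also have "X \<dots> = X (b * b) * X (d * d)" using bd by (intro X_mult) auto
      also have "\<dots> = 0" using False bd by auto
      finally show ?thesis by simp
    qed
    then show ?thesis by (intro exI[of _ "\<lambda>_. 0"]) auto
  qed
  then obtain \<xi> where \<xi>1: "\<forall>b d. star b = - b \<longrightarrow> star d = - d \<longrightarrow> \<xi> (b + d) = \<xi> b + \<xi> d \<and> - (\<xi> b * \<xi> d) = X (b * d)"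
    and \<xi>2: "\<forall>b r. star b = - b \<longrightarrow> \<xi> (r *\<^sub>R b) = r * \<xi> b"
    and \<xi>3: "\<forall>a b. star a = a \<longrightarrow> star b = - b \<longrightarrow> \<xi> (a * b) = X a * \<xi> b" by blast
  have \<xi>_add: "\<xi> (b + d) = \<xi> b + \<xi> d" and \<xi>_mult: "X (b * d) = - (\<xi> b * \<xi> d)"
    if "star b = - b" "star d = - d" for b d
    using \<xi>1 that by simp_all
  have \<xi>_scale: "\<xi> (r *\<^sub>R b) = r * \<xi> b" if "star b = - b" for b r
    using \<xi>2 that by simp
  have \<xi>_minus: "\<xi> (- b) = - \<xi> b" if "star b = - b" for b
    using \<xi>_scale[OF that, of "- 1"] by simp
  have \<xi>_sa: "\<xi> (a * b) = X a * \<xi> b" if "star a = a" "star b = - b" for a b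
    using \<xi>3 that by simp
  define z where "z x = Complex (X (re x)) (\<xi> (sk x))" for x
  have "gelfand_point z" unfolding gelfand_point_def
  proof (intro conjI allI linearI)
    fix x y :: 'a and r :: real
    have "re (x + y) = re x + re y" "sk (x + y) = sk x + sk y" by (simp_all add: re_def sk_def algebra_simps)
    then show "z (x + y) = z x + z y" by (simp add: z_def complex_eq_iff X_add \<xi>_add re sk)
    have "re (r *\<^sub>R x) = r *\<^sub>R re x" "sk (r *\<^sub>R x) = r *\<^sub>R sk x" by (simp_all add: re_def sk_def algebra_simps)
    then show "z (r *\<^sub>R x) = r *\<^sub>R z x" by (simp add: z_def complex_eq_iff X_scale \<xi>_scale re sk)
    have "re (star x) = re x" "sk (star x) = - sk x" by (simp_all add: re_def sk_def algebra_simps)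
    then show "z (star x) = cnj (z x)" by (simp add: z_def complex_eq_iff \<xi>_minus[OF sk])
    have split: "re (p + q) = p" "sk (p + q) = q" if "star p = p" "star q = - q" for p q
      using that by (simp_all add: re_def sk_def flip: scaleR_2)
    have xy: "x * y = (re x * re y + sk x * sk y) + (re x * sk y + re y * sk x)"
      using dec[of x] dec[of y] by (metis (no_types, opaque_lifting) add.assoc add.commute distrib_left distrib_right mult.commute)
    have "re (x * y) = re x * re y + sk x * sk y" "sk (x * y) = re x * sk y + re y * sk x"
      unfolding xy by (intro split; simp add: re sk)+
    then show "z (x * y) = z x * z y"
      by (simp add: z_def complex_eq_iff X_add X_mult \<xi>_add \<xi>_mult \<xi>_sa re sk)
  qed
  moreover have "z (sa_val h) = of_real (\<gamma> h)" for h
  proof -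
    have "re (sa_val h) = sa_val h" "sk (sa_val h) = 0" by (simp_all add: re_def sk_def flip: scaleR_2)
    moreover have "\<xi> 0 = 0" using \<xi>_scale[of 0 0] by simp
    ultimately show ?thesis by (simp add: z_def Xval complex_eq_iff)
  qed
  ultimately show ?thesis by blast
qed

lemma gelfand_point_norm_square:
  assumes "gelfand_point z"
  shows "z (star x * x) = of_real ((cmod (z x))\<^sup>2)"
  by (simp only: gelfand_pointD[OF assms] complex_norm_square mult.commute)

theorem gelfand_point_norm_attained:
  fixes x :: "'a::{real_cstar_algebra, comm_ring}"
  assumes "x \<noteq> 0"
  shows "\<exists>z. gelfand_point z \<and> cmod (z x) = norm x"
proof -
  define h where "h = Sa (star x * x)"
  have h: "sa_val h = star x * x" by (simp add: h_def Sa_inverse mult.commute)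
  have n: "norm h = (norm x)\<^sup>2" by (simp add: norm_selfadjoint.rep_eq h norm_star_mult_self)
  then have "h \<noteq> 0" using assms by auto
  then obtain \<gamma> where \<gamma>: "character \<gamma>" "\<bar>\<gamma> h\<bar> = norm h" using character_norm_attained by blast
  then obtain z where z: "gelfand_point z" "\<forall>h. z (sa_val h) = of_real (\<gamma> h)" using gelfand_point_of_character by blast
  have "of_real ((cmod (z x))\<^sup>2) = (of_real (\<gamma> h) :: complex)"
    using z(2) h gelfand_point_norm_square[OF z(1), of x] by metis
  then have "(cmod (z x))\<^sup>2 = \<gamma> h" by (simp only: of_real_eq_iff)
  moreover have "0 \<le> (cmod (z x))\<^sup>2" by simp
  ultimately have "(cmod (z x))\<^sup>2 = (norm x)\<^sup>2" using \<gamma>(2) n by linarith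
  then have "cmod (z x) = norm x" by (simp add: power2_eq_iff_nonneg)
  with z(1) show ?thesis by blast
qed

lemma gelfand_point_le_norm:
  assumes "gelfand_point z"
  shows "cmod (z x) \<le> norm x"
proof -
  define h where "h = Sa (star x * x)"
  have h: "sa_val h = star x * x" by (simp add: h_def Sa_inverse mult.commute)
  have "\<bar>Re (z (sa_val h))\<bar> \<le> norm h" by (rule character_le_norm[OF character_of_gelfand_point[OF assms]])
  then have "(cmod (z x))\<^sup>2 \<le> (norm x)\<^sup>2"
    unfolding h gelfand_point_norm_square[OF assms] by (simp add: norm_selfadjoint.rep_eq h norm_star_mult_self)
  then show ?thesis by (simp add: power2_le_iff_abs_le)
qed

lemma norm_le_of_gelfand_points:
  assumes "\<And>z. gelfand_point z \<Longrightarrow> cmod (z x) \<le> c" "c \<ge> 0"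
  shows "norm x \<le> c"
proof (cases "x = 0")
  case False
  then obtain z where "gelfand_point z" "cmod (z x) = norm x" using gelfand_point_norm_attained by blast
  then show ?thesis using assms(1)[of z] by simp
qed (use assms in simp)

lemma eq_of_gelfand_points:
  assumes "\<And>z. gelfand_point z \<Longrightarrow> z x = z y"
  shows "x = y"
proof -
  have "norm (x - y) \<le> 0"
    by (rule norm_le_of_gelfand_points) (simp_all add: gelfand_pointD assms)
  then show ?thesis by simp
qed

theorem continuous_calculus:
  fixes h :: "'a::{real_cstar_algebra, comm_ring}"
  assumes "star h = h" "continuous_on UNIV f" "f 0 = 0"
  shows "\<exists>k. star k = k \<and> (\<forall>z. gelfand_point z \<longrightarrow> z k = of_real (f (Re (z h))))"
proof -
  have h: "sa_val (Sa h) = h" using assms(1) by (simp add: Sa_inverse)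
  obtain b where b: "\<forall>\<gamma>. character \<gamma> \<longrightarrow> \<gamma> b = f (\<gamma> (Sa h))"
    using continuous_calculus_characters[OF assms(2,3)] by blast
  show ?thesis
  proof (intro exI[of _ "sa_val b"] conjI allI impI)
    fix z :: "'a \<Rightarrow> complex" assume z: "gelfand_point z"
    have "Re (z (sa_val b)) = f (Re (z h))" using b character_of_gelfand_point[OF z] h by fastforce
    then show "z (sa_val b) = of_real (f (Re (z h)))"
      using gelfand_point_selfadjoint[OF z, of "sa_val b"] by simp
  qed simp
qed

section \<open>Random signs\<close>

text \<open>
  The expectation of \<open>G (\<Sum>i<n. \<plusminus>x\<^sub>i)\<close> over independent uniform signs. The recursion on \<open>n\<close>
  replaces a probability space; statements with a free shift of the argument are
  the ones that pass through it.
\<close>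
fun rmean :: "(nat \<Rightarrow> 'v::real_vector) \<Rightarrow> nat \<Rightarrow> ('v \<Rightarrow> 'w::real_vector) \<Rightarrow> 'w" where
  "rmean x 0 G = G 0"
| "rmean x (Suc n) G = (1/2) *\<^sub>R (rmean x n (\<lambda>s. G (s + x n)) + rmean x n (\<lambda>s. G (s - x n)))"

fun sign_sums :: "(nat \<Rightarrow> 'v::real_vector) \<Rightarrow> nat \<Rightarrow> 'v set" where
  "sign_sums x 0 = {0}"
| "sign_sums x (Suc n) = (\<lambda>s. s + x n) ` sign_sums x n \<union> (\<lambda>s. s - x n) ` sign_sums x n"

lemma rmean_add: "rmean x n (\<lambda>s. G s + H s) = rmean x n G + rmean x n H"
  by (induction n arbitrary: G H) (simp_all add: scaleR_right_distrib)

lemma rmean_linear: "linear L \<Longrightarrow> L (rmean x n G) = rmean x n (\<lambda>s. L (G s))"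
  by (induction n arbitrary: G) (simp_all add: linear_add linear_scale)

lemma rmean_cong: "(\<And>s. s \<in> sign_sums x n \<Longrightarrow> G s = H s) \<Longrightarrow> rmean x n G = rmean x n H"
proof (induction n arbitrary: G H)
  case (Suc n)
  have "rmean x n (\<lambda>s. G (s + x n)) = rmean x n (\<lambda>s. H (s + x n))"
    "rmean x n (\<lambda>s. G (s - x n)) = rmean x n (\<lambda>s. H (s - x n))"
    using Suc.prems by (intro Suc.IH; simp)+
  then show ?case by simp
qed simp

lemma rmean_mono:
  fixes G H :: "'v::real_vector \<Rightarrow> real"
  shows "(\<And>s. s \<in> sign_sums x n \<Longrightarrow> G s \<le> H s) \<Longrightarrow> rmean x n G \<le> rmean x n H"
proof (induction n arbitrary: G H)
  case (Suc n)
  have "rmean x n (\<lambda>s. G (s + x n)) \<le> rmean x n (\<lambda>s. H (s + x n))" using Suc.prems by (intro Suc.IH) auto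
  moreover have "rmean x n (\<lambda>s. G (s - x n)) \<le> rmean x n (\<lambda>s. H (s - x n))" using Suc.prems by (intro Suc.IH) auto
  ultimately show ?case by simp
qed simp

lemma rmean_const [simp]: "rmean x n (\<lambda>s. c) = c"
  by (induction n) (simp_all flip: scaleR_2)

lemma norm_rmean_le:
  fixes G :: "'v::real_vector \<Rightarrow> 'w::real_normed_vector"
  shows "norm (rmean x n G) \<le> rmean x n (\<lambda>s. norm (G s))"
proof (induction n arbitrary: G)
  case (Suc n)
  have "norm (rmean x (Suc n) G) \<le> (1/2) * (norm (rmean x n (\<lambda>s. G (s + x n))) + norm (rmean x n (\<lambda>s. G (s - x n))))"
    by (simp add: norm_triangle_ineq)
  also have "\<dots> \<le> (1/2) * (rmean x n (\<lambda>s. norm (G (s + x n))) + rmean x n (\<lambda>s. norm (G (s - x n))))"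
    by (intro mult_left_mono add_mono Suc.IH) simp
  finally show ?case by simp
qed simp

lemma norm_rmean_le_const:
  fixes G :: "'v::real_vector \<Rightarrow> 'w::real_normed_vector"
  assumes "\<And>s. s \<in> sign_sums x n \<Longrightarrow> norm (G s) \<le> C"
  shows "norm (rmean x n G) \<le> C"
proof -
  have "norm (rmean x n G) \<le> rmean x n (\<lambda>s. norm (G s))" by (rule norm_rmean_le)
  also have "\<dots> \<le> rmean x n (\<lambda>s. C)" using assms by (intro rmean_mono)
  finally show ?thesis by simp
qed

lemma sign_sums_linear: "linear L \<Longrightarrow> s \<in> sign_sums x n \<Longrightarrow> L s \<in> sign_sums (\<lambda>i. L (x i)) n"
  by (induction n arbitrary: s) (auto simp: linear_0 linear_add linear_diff)

lemma rmean_map: "linear L \<Longrightarrow> rmean x n (\<lambda>s. G (L s)) = rmean (\<lambda>i. L (x i)) n G"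
proof (induction n arbitrary: G)
  case (Suc n)
  then show ?case
    using Suc.IH[of "\<lambda>s. G (s + L (x n))"] Suc.IH[of "\<lambda>s. G (s - L (x n))"] by (simp add: linear_add linear_diff)
qed (simp add: linear_0)

lemma sign_sums_abs_le:
  fixes x :: "nat \<Rightarrow> real"
  shows "s \<in> sign_sums x n \<Longrightarrow> \<bar>s\<bar> \<le> (\<Sum>i<n. \<bar>x i\<bar>)"
  by (induction n arbitrary: s) (auto intro: order_trans[OF abs_triangle_ineq] order_trans[OF abs_triangle_ineq4] add_mono)

text \<open>
  Orthogonality of the signs: only the diagonal terms of the double sum survive.
\<close>
lemma rmean_bilinear:
  assumes "bounded_bilinear B"
  shows "rmean (\<lambda>i. (f i, g i)) n (\<lambda>s. B (fst s + a) (snd s + b)) = B a b + (\<Sum>i<n. B (f i) (g i))"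
proof (induction n arbitrary: a b)
  case (Suc n)
  interpret bounded_bilinear B by fact
  have 1: "rmean (\<lambda>i. (f i, g i)) n (\<lambda>s. B (fst (s + (f n, g n)) + a) (snd (s + (f n, g n)) + b))
      = B (f n + a) (g n + b) + (\<Sum>i<n. B (f i) (g i))"
    unfolding Suc.IH[symmetric] by (simp add: add.assoc)
  have 2: "rmean (\<lambda>i. (f i, g i)) n (\<lambda>s. B (fst (s - (f n, g n)) + a) (snd (s - (f n, g n)) + b))
      = B (a - f n) (b - g n) + (\<Sum>i<n. B (f i) (g i))"
    unfolding Suc.IH[symmetric] by (simp add: algebra_simps)
  have "(B (f n + a) (g n + b) + S) + (B (a - f n) (b - g n) + S) = 2 *\<^sub>R (B a b + (S + B (f n) (g n)))" for S
    by (simp add: add_left add_right diff_left diff_right scaleR_2 algebra_simps)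
  then show ?case unfolding rmean.simps 1 2 by simp
qed simp

text \<open>
  For \<open>a = 0\<close> this is Khintchine's inequality for the fourth moment with the Gaussian constant 3.
\<close>
lemma rmean_fourth_moment:
  fixes x :: "nat \<Rightarrow> real"
  shows "rmean x n (\<lambda>s. (s + a) ^ 4) \<le> a ^ 4 + 6 * a\<^sup>2 * (\<Sum>i<n. (x i)\<^sup>2) + 3 * (\<Sum>i<n. (x i)\<^sup>2)\<^sup>2"
proof (induction n arbitrary: a)
  case (Suc n)
  define S where "S = (\<Sum>i<n. (x i)\<^sup>2)"
  have 1: "rmean x n (\<lambda>s. (s + x n + a) ^ 4) \<le> (x n + a) ^ 4 + 6 * (x n + a)\<^sup>2 * S + 3 * S\<^sup>2"
    using Suc.IH[of "x n + a"] by (simp add: S_def add.assoc)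
  have 2: "rmean x n (\<lambda>s. (s - x n + a) ^ 4) \<le> (a - x n) ^ 4 + 6 * (a - x n)\<^sup>2 * S + 3 * S\<^sup>2"
    using Suc.IH[of "a - x n"] by (simp add: S_def algebra_simps)
  have "rmean x (Suc n) (\<lambda>s. (s + a) ^ 4)
      \<le> (1/2) * (((x n + a) ^ 4 + 6 * (x n + a)\<^sup>2 * S + 3 * S\<^sup>2) + ((a - x n) ^ 4 + 6 * (a - x n)\<^sup>2 * S + 3 * S\<^sup>2))"
    using 1 2 by simp
  also have "\<dots> = a ^ 4 + 6 * a\<^sup>2 * (S + (x n)\<^sup>2) + 3 * (S + (x n)\<^sup>2)\<^sup>2 - 2 * (x n) ^ 4"
    by (simp add: power2_eq_square power4_eq_xxxx algebra_simps)
  also have "\<dots> \<le> a ^ 4 + 6 * a\<^sup>2 * (S + (x n)\<^sup>2) + 3 * (S + (x n)\<^sup>2)\<^sup>2" by simp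
  finally show ?case by (simp add: S_def)
qed simp

section \<open>Tents and multipliers\<close>
definition clamp01 :: "real \<Rightarrow> real" where "clamp01 v = max 0 (min 1 v)"
text \<open>
  The piecewise linear hat function of height 1 with support \<open>[i - 1, i + 1]\<close>. As a difference of two
  clamped ramps it makes the sums below telescope.
\<close>
definition tent :: "nat \<Rightarrow> real \<Rightarrow> real" where "tent i u = clamp01 (u - i + 1) - clamp01 (u - i)"

lemma tent_nonneg: "tent i u \<ge> 0"
  by (simp add: tent_def clamp01_def)

lemma tent_disjoint: "i + 2 \<le> j \<or> j + 2 \<le> i \<Longrightarrow> tent i u * tent j u = 0"
  by (auto simp: tent_def clamp01_def max_def min_def)

lemma continuous_on_tent [continuous_intros]: "continuous_on S f \<Longrightarrow> continuous_on S (\<lambda>t. tent i (f t))"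
  unfolding tent_def clamp01_def by (intro continuous_intros)

lemma sum_tent: "(\<Sum>i<m. tent i u) = clamp01 (u + 1) - clamp01 (u - m + 1)"
  by (induction m) (simp_all add: tent_def algebra_simps)

lemma sum_tent_le_one: "(\<Sum>i<m. tent i u) \<le> 1"
  unfolding sum_tent by (simp add: clamp01_def)

lemma tent_Suc: "tent (Suc i) u = tent i (u - 1)"
  by (simp add: tent_def algebra_simps)

lemma sum_tent_eq_one: "0 \<le> u \<Longrightarrow> u \<le> real m - 1 \<Longrightarrow> (\<Sum>i<m. tent i u) = 1"
  unfolding sum_tent by (simp add: clamp01_def)

lemma sum_index_tent:
  assumes "0 \<le> u" "u \<le> real m - 1"
  shows "(\<Sum>i<m. real i * tent i u) = u"
proof -
  have 1: "(\<Sum>i<m. clamp01 (u - i)) = min u m" for m :: nat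
    using assms(1) by (induction m) (auto simp: clamp01_def)
  have "(\<Sum>i<m. real i * tent i u) = (\<Sum>i<m. clamp01 (u - i)) - m * clamp01 (u - m + 1)" for m :: nat
    by (induction m) (simp_all add: tent_def algebra_simps)
  then show ?thesis using assms unfolding 1 by (simp add: clamp01_def)
qed

text \<open>
  The product \<open>f(h) x\<close> for self-adjoint \<open>h\<close> and continuous \<open>f\<close>. It makes sense as an element of the
  algebra even if \<open>f 0 \<noteq> 0\<close>, when \<open>f(h)\<close> itself may fail to be one. The points determine it uniquely.
\<close>
definition calc :: "(real \<Rightarrow> real) \<Rightarrow> 'a::{real_cstar_algebra, comm_ring} \<Rightarrow> 'a \<Rightarrow> 'a"
  where "calc f h x = (SOME y. \<forall>z. gelfand_point z \<longrightarrow> z y = of_real (f (Re (z h))) * z x)"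

lemma gelfand_point_calc:
  assumes "gelfand_point z" "star h = h" "continuous_on UNIV f"
  shows "z (calc f h x) = of_real (f (Re (z h))) * z x"
proof -
  have "continuous_on UNIV (\<lambda>t. f t - f 0)" using assms(3) by (intro continuous_intros)
  then obtain k where k: "\<forall>z. gelfand_point z \<longrightarrow> z k = of_real (f (Re (z h)) - f 0)"
    using continuous_calculus[OF assms(2), of "\<lambda>t. f t - f 0"] by auto
  have "z (f 0 *\<^sub>R x + k * x) = of_real (f (Re (z h))) * z x" if z: "gelfand_point z" for z
  proof -
    have "z k = of_real (f (Re (z h)) - f 0)" using k z by blast
    then show ?thesis by (simp add: gelfand_pointD(1,3,5)[OF z] left_diff_distrib)
  qed
  then have "\<forall>z. gelfand_point z \<longrightarrow> z (f 0 *\<^sub>R x + k * x) = of_real (f (Re (z h))) * z x" by blast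
  then have "\<forall>z. gelfand_point z \<longrightarrow> z (calc f h x) = of_real (f (Re (z h))) * z x"
    unfolding calc_def by (rule someI)
  then show ?thesis using assms(1) by blast
qed

lemma star_calc:
  assumes "star h = h" "continuous_on UNIV f"
  shows "star (calc f h x) = calc f h (star x)"
  by (rule eq_of_gelfand_points) (simp add: gelfand_pointD(6) gelfand_point_calc assms)

lemma gelfand_point_selfadjoint_abs_le:
  assumes "gelfand_point z" "star h = h"
  shows "\<bar>Re (z h)\<bar> \<le> norm h"
  using gelfand_point_le_norm[OF assms(1), of h] abs_Re_le_cmod[of "z h"] by linarith

section \<open>Local forms are balanced\<close>
locale local_form =
  fixes V :: "'a::{real_cstar_algebra, comm_ring} \<Rightarrow> 'a \<Rightarrow> real" and K :: real
  assumes bilinear: "bounded_bilinear V"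
    and bound: "\<bar>V a b\<bar> \<le> K * norm a * norm b"
    and K_nonneg: "K \<ge> 0"
    and local: "a * b = 0 \<Longrightarrow> V a b = 0"
begin

lemmas V_simps = bounded_bilinear.add_left[OF bilinear] bounded_bilinear.add_right[OF bilinear]
  bounded_bilinear.diff_left[OF bilinear] bounded_bilinear.diff_right[OF bilinear]
  bounded_bilinear.scaleR_left[OF bilinear] bounded_bilinear.scaleR_right[OF bilinear]
  bounded_bilinear.minus_left[OF bilinear] bounded_bilinear.minus_right[OF bilinear]
  bounded_bilinear.zero_left[OF bilinear] bounded_bilinear.zero_right[OF bilinear]

lemma bound_mono: "norm a \<le> A \<Longrightarrow> norm b \<le> B \<Longrightarrow> \<bar>V a b\<bar> \<le> K * A * B"
  using bound[of a b] K_nonneg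
  by (smt (verit, best) mult_left_mono mult_right_mono norm_ge_zero mult_mono mult_nonneg_nonneg)

text \<open>
  A diagonal sum is the mean of \<open>V (\<Sum> \<plusminus>f\<^sub>i) (\<Sum> \<plusminus>g\<^sub>i)\<close>, so the number of terms does not enter the bound.
\<close>
lemma sum_bound_by_signs:
  assumes "\<And>s. s \<in> sign_sums f n \<Longrightarrow> norm s \<le> A" "\<And>s. s \<in> sign_sums g n \<Longrightarrow> norm s \<le> B"
  shows "\<bar>\<Sum>i<n. V (f i) (g i)\<bar> \<le> K * A * B"
proof -
  have "norm (rmean (\<lambda>i. (f i, g i)) n (\<lambda>s. V (fst s + 0) (snd s + 0))) \<le> K * A * B"
  proof (rule norm_rmean_le_const)
    fix s assume s: "s \<in> sign_sums (\<lambda>i. (f i, g i)) n"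
    have "fst s \<in> sign_sums f n" "snd s \<in> sign_sums g n"
      using sign_sums_linear[OF linear_fst s] sign_sums_linear[OF linear_snd s] by simp_all
    then have "norm (fst s) \<le> A" "norm (snd s) \<le> B" using assms by blast+
    from bound_mono[OF this] show "norm (V (fst s + 0) (snd s + 0)) \<le> K * A * B" by simp
  qed
  then show ?thesis unfolding rmean_bilinear[OF bilinear] by (simp add: V_simps)
qed

text \<open>
  Signed sums of tents are bounded by 1 because the tents are nonnegative with sum at most 1.
\<close>
lemma tent_sum_bound:
  assumes h: "star h = h" and u: "continuous_on UNIV u" "continuous_on UNIV v"
  shows "\<bar>\<Sum>i<m. V (calc (\<lambda>t. tent i (u t)) h x) (calc (\<lambda>t. tent i (v t)) h y)\<bar> \<le> K * norm x * norm y"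
proof -
  have *: "norm s \<le> norm x" if s: "s \<in> sign_sums (\<lambda>i. calc (\<lambda>t. tent i (u t)) h x) m" and u: "continuous_on UNIV u"
    for s x and u :: "real \<Rightarrow> real"
  proof (rule norm_le_of_gelfand_points)
    fix z :: "'a \<Rightarrow> complex" assume z: "gelfand_point z"
    have lin: "linear z" using z by (simp add: gelfand_point_def)
    define d where "d i = tent i (u (Re (z h)))" for i
    have zi: "z (calc (\<lambda>t. tent i (u t)) h x) = d i *\<^sub>R z x" for i
      using gelfand_point_calc[OF z h, of "\<lambda>t. tent i (u t)" x] u
      by (simp add: d_def scaleR_conv_of_real continuous_on_tent)
    have "z s \<in> sign_sums (\<lambda>i. d i *\<^sub>R z x) m" using sign_sums_linear[OF lin s] unfolding zi .
    moreover have "sign_sums (\<lambda>i. d i *\<^sub>R z x) m = (\<lambda>r. r *\<^sub>R z x) ` sign_sums d m"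
      by (induction m) (simp_all add: image_Un image_image scaleR_left_distrib scaleR_left_diff_distrib)
    ultimately obtain r where r: "r \<in> sign_sums d m" "z s = r *\<^sub>R z x" by auto
    have "\<bar>r\<bar> \<le> (\<Sum>i<m. \<bar>d i\<bar>)" using r(1) by (rule sign_sums_abs_le)
    also have "\<dots> \<le> 1" using sum_tent_le_one[where m = m] by (simp add: d_def tent_nonneg)
    finally have "\<bar>r\<bar> * cmod (z x) \<le> 1 * norm x"
      by (intro mult_mono gelfand_point_le_norm z) auto
    then show "cmod (z s) \<le> norm x" by (simp add: r(2))
  qed simp
  show ?thesis by (rule sum_bound_by_signs) (erule *[OF _ u(1)], erule *[OF _ u(2)])
qed

text \<open>
  Write \<open>x = \<Sum> d\<^sub>i(h) x\<close> and \<open>h x = \<Sum> t\<^sub>i d\<^sub>i(h) x\<close>, where \<open>t\<^sub>i = \<delta> i - R\<close> are the grid points; both are exact, since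
  tents interpolate the identity function. The difference of the two sides is
  \<open>\<Sum> (t\<^sub>i - t\<^sub>j) V (d\<^sub>i(h) x) (d\<^sub>j(h) y)\<close>. Terms with \<open>\<bar>i - j\<bar> \<ge> 2\<close> vanish by
  locality, and the two neighbouring diagonals carry the factor \<open>\<plusminus>\<delta>\<close> in front of sums bounded by
  the previous lemma.
\<close>
theorem balanced:
  assumes h: "star h = h"
  shows "V (h * x) y = V x (h * y)"
proof -
  have "\<bar>V (h * x) y - V x (h * y)\<bar> \<le> \<delta> * (2 * (K * norm x * norm y))" if \<delta>: "\<delta> > 0" for \<delta>
  proof -
    define R where "R = norm h"
    obtain m0 :: nat where m0: "2 * R / \<delta> < real m0" using reals_Archimedean2 by blast
    (* m grid points cover [-R, R], the range of the values of h *)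
    define m where "m = Suc m0"
    define u where "u t = (t + R) / \<delta>" for t
    have u: "continuous_on UNIV u" unfolding u_def using \<delta> by (intro continuous_intros) auto
    define D where "D i = calc (\<lambda>t. tent i (u t)) h" for i
    have zD: "z (D i x) = of_real (tent i (u (Re (z h)))) * z x" if "gelfand_point z" for i x z
      unfolding D_def using that u by (intro gelfand_point_calc h continuous_on_tent)
    have ur: "0 \<le> u (Re (z h))" "u (Re (z h)) \<le> real m - 1" if z: "gelfand_point z" for z
    proof -
      have r: "\<bar>Re (z h)\<bar> \<le> R" using gelfand_point_selfadjoint_abs_le[OF z h] by (simp add: R_def)
      then show "0 \<le> u (Re (z h))" using \<delta> by (simp add: u_def)
      have "u (Re (z h)) \<le> 2 * R / \<delta>" unfolding u_def using r \<delta> by (intro divide_right_mono) auto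
      then show "u (Re (z h)) \<le> real m - 1" using m0 by (simp add: m_def)
    qed
    have sum1: "(\<Sum>i<m. D i x) = x" for x
    proof (rule eq_of_gelfand_points)
      fix z :: "'a \<Rightarrow> complex" assume z: "gelfand_point z"
      have "z (\<Sum>i<m. D i x) = of_real (\<Sum>i<m. tent i (u (Re (z h)))) * z x"
        by (simp add: gelfand_pointD(8)[OF z] zD[OF z] sum_distrib_right)
      then show "z (\<Sum>i<m. D i x) = z x" using sum_tent_eq_one[OF ur[OF z]] by simp
    qed
    have sumh: "(\<Sum>i<m. (\<delta> * i - R) *\<^sub>R D i x) = h * x" for x
    proof (rule eq_of_gelfand_points)
      fix z :: "'a \<Rightarrow> complex" assume z: "gelfand_point z"
      define w where "w = u (Re (z h))"
      have "z (\<Sum>i<m. (\<delta> * i - R) *\<^sub>R D i x) = of_real (\<Sum>i<m. (\<delta> * i - R) * tent i w) * z x"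
        by (simp add: gelfand_pointD(3,8)[OF z] zD[OF z] sum_distrib_right w_def mult.assoc)
      also have "(\<Sum>i<m. (\<delta> * i - R) * tent i w) = \<delta> * (\<Sum>i<m. i * tent i w) - R * (\<Sum>i<m. tent i w)"
        by (simp add: left_diff_distrib sum_subtractf sum_distrib_left mult.assoc)
      also have "\<dots> = \<delta> * w - R"
        using sum_tent_eq_one[OF ur[OF z]] sum_index_tent[OF ur[OF z]] by (simp add: w_def)
      also have "\<dots> = Re (z h)" using \<delta> by (simp add: w_def u_def)
      finally show "z (\<Sum>i<m. (\<delta> * i - R) *\<^sub>R D i x) = z (h * x)"
        using gelfand_point_selfadjoint[OF z h] by (simp add: gelfand_pointD(5)[OF z])
    qed
    define W where "W i j = V (D i x) (D j y)" for i j
    have W0: "W i j = 0" if "i + 2 \<le> j \<or> j + 2 \<le> i" for i j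
      unfolding W_def
    proof (intro local eq_of_gelfand_points)
      fix z :: "'a \<Rightarrow> complex" assume z: "gelfand_point z"
      have "z (D i x * D j y) = of_real (tent i (u (Re (z h))) * tent j (u (Re (z h)))) * (z x * z y)"
        by (simp add: gelfand_pointD(5)[OF z] zD[OF z])
      then show "z (D i x * D j y) = z 0" using tent_disjoint[OF that] by (simp add: gelfand_pointD(4)[OF z])
    qed
    have "V (h * x) y = V (\<Sum>i<m. (\<delta> * i - R) *\<^sub>R D i x) (\<Sum>j<m. D j y)" unfolding sum1 sumh ..
    also have "\<dots> = (\<Sum>i<m. \<Sum>j<m. (\<delta> * i - R) * W i j)"
      unfolding bounded_bilinear.sum_left[OF bilinear]
      by (simp add: bounded_bilinear.sum_right[OF bilinear] V_simps W_def)
    finally have V1: "V (h * x) y = (\<Sum>i<m. \<Sum>j<m. (\<delta> * i - R) * W i j)" .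
    have "V x (h * y) = V (\<Sum>i<m. D i x) (\<Sum>j<m. (\<delta> * j - R) *\<^sub>R D j y)" unfolding sum1 sumh ..
    also have "\<dots> = (\<Sum>i<m. \<Sum>j<m. (\<delta> * j - R) * W i j)"
      unfolding bounded_bilinear.sum_left[OF bilinear]
      by (simp add: bounded_bilinear.sum_right[OF bilinear] V_simps W_def)
    finally have V2: "V x (h * y) = (\<Sum>i<m. \<Sum>j<m. (\<delta> * j - R) * W i j)" .
    have wdiff: "(\<delta> * i - R) * W i j - (\<delta> * j - R) * W i j
        = \<delta> * ((if i = Suc j then W i j else 0) - (if j = Suc i then W i j else 0))" for i j
    proof -
      consider "i + 2 \<le> j \<or> j + 2 \<le> i" | "i = j" | "i = Suc j" | "j = Suc i" by linarith
      then show ?thesis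
      proof cases
        case 1
        then have "W i j = 0" "i \<noteq> Suc j" "j \<noteq> Suc i" using W0 by auto
        then show ?thesis by simp
      qed (auto simp: algebra_simps)
    qed
    have up: "(\<Sum>i<m. \<Sum>j<m. if i = Suc j then W i j else 0) = (\<Sum>j<m0. W (Suc j) j)"
    proof -
      have "(\<Sum>i<m. \<Sum>j<m. if i = Suc j then W i j else 0) = (\<Sum>j<m. \<Sum>i<m. if i = Suc j then W i j else 0)"
        by (rule sum.swap)
      also have "\<dots> = (\<Sum>j<m. if Suc j < m then W (Suc j) j else 0)" by (intro sum.cong refl) simp
      also have "\<dots> = (\<Sum>j<m0. W (Suc j) j)" unfolding m_def by simp
      finally show ?thesis .
    qed
    have down: "(\<Sum>i<m. \<Sum>j<m. if j = Suc i then W i j else 0) = (\<Sum>i<m0. W i (Suc i))"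
    proof -
      have "(\<Sum>i<m. \<Sum>j<m. if j = Suc i then W i j else 0) = (\<Sum>i<m. if Suc i < m then W i (Suc i) else 0)"
        by (intro sum.cong refl) simp
      also have "\<dots> = (\<Sum>i<m0. W i (Suc i))" unfolding m_def by simp
      finally show ?thesis .
    qed
    have "V (h * x) y - V x (h * y) = (\<Sum>i<m. \<Sum>j<m. (\<delta> * i - R) * W i j - (\<delta> * j - R) * W i j)"
      unfolding V1 V2 by (simp only: sum_subtractf)
    also have "\<dots> = \<delta> * (\<Sum>i<m. \<Sum>j<m. (if i = Suc j then W i j else 0) - (if j = Suc i then W i j else 0))"
      by (simp only: wdiff sum_distrib_left)
    also have "\<dots> = \<delta> * ((\<Sum>j<m0. W (Suc j) j) - (\<Sum>i<m0. W i (Suc i)))"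
      by (simp only: sum_subtractf up down)
    finally have "V (h * x) y - V x (h * y) = \<delta> * ((\<Sum>j<m0. W (Suc j) j) - (\<Sum>i<m0. W i (Suc i)))" .
    moreover have u': "continuous_on UNIV (\<lambda>t. u t - 1)" by (intro continuous_intros u)
    have "\<bar>\<Sum>j<m0. W (Suc j) j\<bar> \<le> K * norm x * norm y"
      using tent_sum_bound[OF h u' u, where m = m0 and x = x and y = y] by (simp add: W_def D_def tent_Suc)
    moreover have "\<bar>\<Sum>i<m0. W i (Suc i)\<bar> \<le> K * norm x * norm y"
      using tent_sum_bound[OF h u u', where m = m0 and x = x and y = y] by (simp add: W_def D_def tent_Suc)
    ultimately show ?thesis using \<delta> by (simp add: abs_mult)
  qed
  note small = this
  define C where "C = 2 * (K * norm x * norm y)"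
  have C: "C \<ge> 0" unfolding C_def using K_nonneg by simp
  have "\<bar>V (h * x) y - V x (h * y)\<bar> \<le> 0"
  proof (rule field_le_epsilon)
    fix e :: real assume e: "e > 0"
    have "\<bar>V (h * x) y - V x (h * y)\<bar> \<le> e / (C + 1) * C" using small[of "e / (C + 1)"] e C by (simp add: C_def)
    also have "\<dots> \<le> 0 + e" using e C by (simp add: field_simps)
    finally show "\<bar>V (h * x) y - V x (h * y)\<bar> \<le> 0 + e" .
  qed
  then show ?thesis by simp
qed

end

section \<open>Approximate units\<close>
lemma approximation_error:
  assumes a: "0 \<le> a" "a\<^sup>2 \<le> T" and \<eta>: "\<eta> > (0::real)"
  shows "a * (1 - T / (\<eta> + T)) \<le> sqrt \<eta>"
proof -
  have T: "T \<ge> 0" using a(2) zero_le_power2[of a] by linarith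
  have aT: "a \<le> sqrt T" using a by (simp add: real_le_rsqrt)
  have am: "sqrt T * sqrt \<eta> \<le> \<eta> + T"
    using arith_geo_mean_sqrt[of T \<eta>] T \<eta> by (simp add: real_sqrt_mult)
  have "1 - T / (\<eta> + T) = \<eta> / (\<eta> + T)" using T \<eta> by (simp add: field_simps)
  then have "a * (1 - T / (\<eta> + T)) \<le> sqrt T * (\<eta> / (\<eta> + T))"
    using aT T \<eta> by (simp only:) (intro mult_right_mono, auto)
  also have "\<dots> = sqrt \<eta> * (sqrt T * sqrt \<eta> / (\<eta> + T))" using \<eta> by simp
  also have "\<dots> \<le> sqrt \<eta> * 1" using am T \<eta> by (intro mult_left_mono) (auto simp: divide_le_eq)
  finally show ?thesis by simp
qed

text \<open>
  With \<open>T = \<Sum> \<bar>x\<bar>\<^sup>2\<close>, the function \<open>e = T / (\<eta> + T)\<close> is close to 1 wherever some \<open>x \<in> P\<close> is not small.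
\<close>
lemma approximate_unit_error:
  fixes P :: "'a::{real_cstar_algebra, comm_ring} set"
  assumes P: "finite P" "x \<in> P" and \<eta>: "\<eta> > 0" and T: "T = (\<Sum>x\<in>P. star x * x)"
    and e: "\<And>z. gelfand_point z \<Longrightarrow> z e = of_real (\<bar>Re (z T)\<bar> / (\<eta> + \<bar>Re (z T)\<bar>))"
  shows "norm (e * x - x) \<le> sqrt \<eta>"
proof (rule norm_le_of_gelfand_points)
  fix z :: "'a \<Rightarrow> complex" assume z: "gelfand_point z"
  define t where "t = (\<Sum>x\<in>P. (cmod (z x))\<^sup>2)"
  have zT: "z T = of_real t"
    unfolding T t_def by (simp add: gelfand_pointD(8)[OF z] gelfand_point_norm_square[OF z] del: of_real_power)
  have t: "0 \<le> t" "(cmod (z x))\<^sup>2 \<le> t"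
    unfolding t_def using P by (auto intro: sum_nonneg member_le_sum)
  have q: "t / (\<eta> + t) \<le> 1" using t \<eta> by (simp add: divide_le_eq)
  have "z (e * x - x) = of_real (t / (\<eta> + t) - 1) * z x"
    using e[OF z] t by (simp add: gelfand_pointD(2,5)[OF z] zT left_diff_distrib)
  then have "cmod (z (e * x - x)) = \<bar>t / (\<eta> + t) - 1\<bar> * cmod (z x)" by (simp only: norm_mult norm_of_real)
  also have "\<dots> = cmod (z x) * (1 - t / (\<eta> + t))" using q by simp
  also have "\<dots> \<le> sqrt \<eta>" using t \<eta> by (intro approximation_error) auto
  finally show "cmod (z (e * x - x)) \<le> sqrt \<eta>" .
qed (use \<eta> in simp)

lemma sum_star_mult_self_selfadjoint:
  fixes P :: "'a::{real_cstar_algebra, comm_ring} set"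
  shows "finite P \<Longrightarrow> star (\<Sum>x\<in>P. star x * x) = (\<Sum>x\<in>P. star x * x)"
  by (induction P rule: finite_induct) (simp_all add: mult.commute)

lemma approximate_unit:
  fixes P :: "'a::{real_cstar_algebra, comm_ring} set"
  assumes P: "finite P" and \<epsilon>: "\<epsilon> > 0"
  shows "\<exists>e. star e = e \<and> norm e \<le> 1 \<and> (\<forall>x\<in>P. norm (e * x - x) \<le> \<epsilon>)"
proof -
  define T where "T = (\<Sum>x\<in>P. star x * x)"
  have T: "star T = T" using sum_star_mult_self_selfadjoint[OF P] by (simp only: T_def)
  define f where "f t = \<bar>t\<bar> / (\<epsilon>\<^sup>2 + \<bar>t\<bar>)" for t :: real
  have pos: "\<epsilon>\<^sup>2 + \<bar>t\<bar> > 0" for t :: real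
    using \<epsilon> by (simp add: add_pos_nonneg)
  then have "\<epsilon>\<^sup>2 + \<bar>t\<bar> \<noteq> 0" for t :: real by (metis less_irrefl)
  then have "continuous_on UNIV f" unfolding f_def by (intro continuous_intros) auto
  then obtain e where e: "star e = e" "\<forall>z. gelfand_point z \<longrightarrow> z e = of_real (f (Re (z T)))"
    using continuous_calculus[OF T, of f] by (auto simp: f_def)
  have "norm e \<le> 1"
  proof (rule norm_le_of_gelfand_points)
    fix z :: "'a \<Rightarrow> complex" assume "gelfand_point z"
    then have "z e = of_real (f (Re (z T)))" using e(2) by blast
    moreover have "\<bar>f t\<bar> \<le> 1" for t using pos[of t] by (simp add: f_def divide_le_eq abs_of_pos)
    ultimately show "cmod (z e) \<le> 1" by simp
  qed simp
  moreover have "norm (e * x - x) \<le> \<epsilon>" if "x \<in> P" for x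
    using approximate_unit_error[OF P that _ T_def, of "\<epsilon>\<^sup>2" e] e(2) \<epsilon> by (simp add: f_def)
  ultimately show ?thesis using e(1) by blast
qed

section \<open>An inequality of Grothendieck type\<close>

text \<open>
  With \<open>s = \<bar>f\<bar>\<^sup>2\<close>, the first bound is for the square of the truncation \<open>12 f / (12 + s)\<close>, and the other two are for
  what the truncation removes from \<open>\<bar>f\<bar>\<^sup>2\<close>. Since the fourth moment has the constant 3,
  the level 12 makes the mean of the removed part at most \<open>3/6 = 1/2\<close> of \<open>e\<^sup>2\<close>.
\<close>
lemma mollified_square_bounds:
  fixes s :: real
  assumes "s \<ge> 0"
  shows "s * (12 / (12 + s))\<^sup>2 \<le> 3" "0 \<le> s - s * (12 / (12 + s))\<^sup>2" "s - s * (12 / (12 + s))\<^sup>2 \<le> s\<^sup>2 / 6"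
proof -
  have p: "(12 + s)\<^sup>2 > 0" using assms by simp
  have e: "s * (12 / (12 + s))\<^sup>2 = 144 * s / (12 + s)\<^sup>2" by (simp add: power_divide)
  have "3 * (12 + s)\<^sup>2 - 144 * s = 3 * (s - 12)\<^sup>2" by (simp add: power2_eq_square algebra_simps)
  then have "144 * s \<le> 3 * (12 + s)\<^sup>2" using zero_le_power2[of "s - 12"] by linarith
  then show "s * (12 / (12 + s))\<^sup>2 \<le> 3" unfolding e using p by (simp add: divide_le_eq)
  have d: "s - s * (12 / (12 + s))\<^sup>2 = (24 * s\<^sup>2 + s ^ 3) / (12 + s)\<^sup>2"
    unfolding e using p by (simp add: field_simps power2_eq_square power3_eq_cube)
  show "0 \<le> s - s * (12 / (12 + s))\<^sup>2" unfolding d using assms by simp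
  have "s\<^sup>2 * (12 + s)\<^sup>2 / 6 - (24 * s\<^sup>2 + s ^ 3) = s ^ 3 * (3 + s / 6)"
    by (simp add: power2_eq_square power3_eq_cube algebra_simps)
  moreover have "s ^ 3 * (3 + s / 6) \<ge> 0" using assms by simp
  ultimately have "24 * s\<^sup>2 + s ^ 3 \<le> s\<^sup>2 * (12 + s)\<^sup>2 / 6" by linarith
  then have "24 * s\<^sup>2 + s ^ 3 \<le> s\<^sup>2 / 6 * (12 + s)\<^sup>2" by simp
  then show "s - s * (12 / (12 + s))\<^sup>2 \<le> s\<^sup>2 / 6" unfolding d using p by (simp only: divide_le_eq if_True)
qed

context local_form
begin

context
  fixes c :: "nat \<Rightarrow> 'a" and n :: nat and e :: 'a
  assumes skew: "\<And>j. star (c j) = - c j"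
    and e_def: "e = - (\<Sum>j<n. c j * c j)"
    and e_le: "norm e \<le> 1"
begin

text \<open>
  If the \<open>c\<^sub>j\<close> have \<open>e = \<Sum> \<bar>c\<^sub>j\<bar>\<^sup>2\<close> close to 1, this functional approximately represents \<open>V\<close> on skew
  pairs, by the lemma \<open>trace_form_mult_skew\<close>.
\<close>
definition trace_form :: "'a \<Rightarrow> real" where "trace_form x = - (\<Sum>j<n. V (c j) (c j * x))"

lemma linear_trace_form: "linear trace_form"
  by (rule linearI) (simp_all add: trace_form_def V_simps distrib_left sum.distrib sum_distrib_left)

text \<open>
  This bound grows with the number of the \<open>c\<^sub>j\<close>. It serves as the finite starting point for the bootstrap below.
\<close>
lemma trace_form_bound: "\<bar>trace_form x\<bar> \<le> (\<Sum>j<n. K * norm (c j) * norm (c j)) * norm x"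
proof -
  have "\<bar>trace_form x\<bar> \<le> (\<Sum>j<n. \<bar>V (c j) (c j * x)\<bar>)" unfolding trace_form_def by (simp add: sum_abs)
  also have "\<dots> \<le> (\<Sum>j<n. K * norm (c j) * (norm (c j) * norm x))"
    by (intro sum_mono bound_mono norm_mult_ineq) simp
  finally show ?thesis by (simp add: sum_distrib_right mult.assoc)
qed

text \<open>
  Products \<open>c\<^sub>j p\<close> of skew elements are self-adjoint, so they move across the form:
  \<open>V c\<^sub>j (c\<^sub>j p q) = V (c\<^sub>j\<^sup>2 p) q\<close>.
\<close>
lemma trace_form_mult_skew:
  assumes "star p = - p"
  shows "trace_form (p * q) = V (e * p) q"
proof -
  have "V (c j) (c j * (p * q)) = V (c j * c j * p) q" for j
  proof -
    have "star (c j * p) = c j * p" using skew assms by simp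
    from balanced[OF this, of "c j" q] show ?thesis by (simp add: ac_simps)
  qed
  then have "trace_form (p * q) = - (\<Sum>j<n. V (c j * c j * p) q)" by (simp add: trace_form_def)
  also have "\<dots> = V (e * p) q"
    by (simp add: e_def V_simps sum_distrib_right bounded_bilinear.sum_left[OF bilinear])
  finally show ?thesis .
qed

lemma selfadjoint_e: "star e = e"
proof -
  have "star (\<Sum>j<m. c j * c j) = (\<Sum>j<m. c j * c j)" for m
    by (induction m) (simp_all add: skew)
  then show ?thesis by (simp add: e_def)
qed

lemma gelfand_point_e: "gelfand_point z \<Longrightarrow> z e = of_real (\<Sum>j<n. (Im (z (c j)))\<^sup>2)"
proof -
  assume z: "gelfand_point z"
  have "z (c j) * z (c j) = - of_real ((Im (z (c j)))\<^sup>2)" for j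
    using gelfand_point_skew[OF z skew, of j] by (simp add: complex_eq_iff power2_eq_square)
  then show ?thesis by (simp add: e_def gelfand_pointD(5,7,8)[OF z] sum_negf)
qed

lemma rmean_square: "rmean c n (\<lambda>f. f * f) = - e"
proof -
  have lin: "linear (\<lambda>x :: 'a. (x, x))" by (rule linearI) simp_all
  have "rmean c n (\<lambda>f. f * f) = rmean c n (\<lambda>f. (fst (f, f) + 0) * (snd (f, f) + 0))" by simp
  also have "\<dots> = rmean (\<lambda>i. (c i, c i)) n (\<lambda>s. (fst s + 0) * (snd s + 0))"
    by (rule rmean_map[OF lin, where G = "\<lambda>s. (fst s + 0) * (snd s + 0)"])
  also have "\<dots> = - e" unfolding rmean_bilinear[OF bounded_bilinear_mult] by (simp add: e_def)
  finally show ?thesis .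
qed

text \<open>
  Let \<open>f = \<Sum> \<plusminus>c\<^sub>j\<close>, so that \<open>- e\<close> is the mean of \<open>f\<^sup>2\<close>. Split \<open>f\<^sup>2 = p\<^sup>2 + q\<close>, where \<open>p\<close> is the truncation of
  \<open>f\<close>. The truncated part contributes at most \<open>3 K\<close>, because \<open>w (p\<^sup>2 h) = V (e p) (p h)\<close> for the form \<open>w\<close> under study. The mean
  \<open>r\<close> of \<open>q\<close> satisfies \<open>\<bar>r\<bar> \<le> e\<^sup>2/2\<close> by the fourth moment; hence \<open>r\<close> is approximately \<open>e k\<close> with
  \<open>\<parallel>k\<parallel> \<le> 1/2\<close>, and the assumed bound applied to \<open>k h\<close> costs only \<open>K'/2\<close>.
\<close>
lemma trace_form_improve:
  assumes K': "\<And>h. star h = h \<Longrightarrow> \<bar>trace_form (e * h)\<bar> \<le> K' * norm h" and h: "star h = h"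
  shows "\<bar>trace_form (e * h)\<bar> \<le> (3 * K + K' / 2) * norm h"
proof -
  define \<phi> where "\<phi> t = 12 / (12 + \<bar>t\<bar>)" for t :: real
  have \<phi>: "continuous_on UNIV \<phi>"
  proof -
    have "12 + \<bar>t\<bar> \<noteq> 0" for t :: real using abs_ge_zero[of t] by linarith
    then show ?thesis unfolding \<phi>_def by (intro continuous_intros) auto
  qed
  define p where "p f = calc \<phi> (- (f * f)) f" for f :: 'a
  define q where "q f = f * f - p f * p f" for f :: 'a
  have sum_skew: "star f = - f" if "f \<in> sign_sums c m" for f m
    using that by (induction m arbitrary: f) (auto simp: skew)
  have zp: "z (p f) = of_real (\<phi> ((Im (z f))\<^sup>2)) * z f" if z: "gelfand_point z" and f: "star f = - f" for z f
  proof -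
    have "Re (z (- (f * f))) = (Im (z f))\<^sup>2"
      using gelfand_point_skew[OF z f] by (simp add: gelfand_pointD(5,7)[OF z] power2_eq_square)
    moreover have "star (- (f * f)) = - (f * f)" using f by simp
    ultimately show ?thesis unfolding p_def using gelfand_point_calc[OF z _ \<phi>, of "- (f * f)" f] by simp
  qed
  have p_skew: "star (p f) = - p f" if f: "star f = - f" for f
  proof (rule eq_of_gelfand_points)
    fix z :: "'a \<Rightarrow> complex" assume z: "gelfand_point z"
    have "cnj (z f) = - z f" using gelfand_pointD(6)[OF z, of f] by (simp add: f gelfand_pointD(7)[OF z])
    then show "z (star (p f)) = z (- p f)" by (simp add: gelfand_pointD(6,7)[OF z] zp[OF z f])
  qed
  have norm_pp: "\<bar>trace_form (p f * p f * h)\<bar> \<le> 3 * K * norm h" if f: "star f = - f" for f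
  proof -
    have "norm (p f) \<le> sqrt 3"
    proof (rule norm_le_of_gelfand_points)
      fix z :: "'a \<Rightarrow> complex" assume z: "gelfand_point z"
      define s where "s = (Im (z f))\<^sup>2"
      have "(cmod (z f))\<^sup>2 = s" using gelfand_point_skew[OF z f] by (simp add: cmod_power2 s_def)
      moreover have "(cmod (z (p f)))\<^sup>2 = (\<phi> s)\<^sup>2 * (cmod (z f))\<^sup>2"
        by (simp add: zp[OF z f] norm_mult power_mult_distrib s_def)
      ultimately have "(cmod (z (p f)))\<^sup>2 \<le> 3"
        using mollified_square_bounds(1)[of s] by (simp add: \<phi>_def s_def mult.commute)
      then show "cmod (z (p f)) \<le> sqrt 3" by (rule real_le_rsqrt)
    qed simp
    moreover have "norm (e * p f) \<le> norm e * norm (p f)" by (rule norm_mult_ineq)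
    moreover have "norm e * norm (p f) \<le> 1 * norm (p f)" by (intro mult_right_mono e_le) simp
    moreover have "norm (p f * h) \<le> norm (p f) * norm h" by (rule norm_mult_ineq)
    moreover have "norm (p f) * norm h \<le> sqrt 3 * norm h" using calculation(1) by (intro mult_right_mono) auto
    ultimately have "norm (e * p f) \<le> sqrt 3" "norm (p f * h) \<le> sqrt 3 * norm h" by linarith+
    then have "\<bar>V (e * p f) (p f * h)\<bar> \<le> K * sqrt 3 * (sqrt 3 * norm h)" by (rule bound_mono)
    also have "\<dots> = (sqrt 3 * sqrt 3) * (K * norm h)" by (simp only: ac_simps)
    also have "\<dots> = 3 * K * norm h" by simp
    finally show ?thesis using trace_form_mult_skew[OF p_skew[OF f], of "p f * h"] by (simp add: mult.assoc)
  qed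
  define r where "r = rmean c n q"
  have r_e: "\<exists>\<rho>. z r = of_real \<rho> \<and> \<bar>\<rho>\<bar> \<le> \<epsilon>\<^sup>2 / 2" if z: "gelfand_point z" and \<epsilon>: "z e = of_real \<epsilon>" for z \<epsilon>
  proof -
    have lin: "linear z" "linear (\<lambda>x. Im (z x))" "linear (complex_of_real)"
      using z by (auto simp: gelfand_point_def linear_iff scaleR_conv_of_real)
    define g where "g y = - (y\<^sup>2 - y\<^sup>2 * (\<phi> (y\<^sup>2))\<^sup>2)" for y
    have zq: "z (q f) = of_real (g (Im (z f)))" if "f \<in> sign_sums c n" for f
    proof -
      have f: "star f = - f" using that by (rule sum_skew)
      have "z f * z f = - of_real ((Im (z f))\<^sup>2)"
        using gelfand_point_skew[OF z f] by (simp add: complex_eq_iff power2_eq_square)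
      moreover have "z (q f) = z f * z f - (of_real (\<phi> ((Im (z f))\<^sup>2)))\<^sup>2 * (z f * z f)"
        by (simp add: q_def gelfand_pointD(2,5)[OF z] zp[OF z f] power2_eq_square)
      ultimately show ?thesis by (simp add: g_def)
    qed
    define y where "y j = Im (z (c j))" for j
    have "z r = rmean c n (\<lambda>f. z (q f))" unfolding r_def by (rule rmean_linear[OF lin(1)])
    also have "\<dots> = rmean c n (\<lambda>f. of_real (g (Im (z f))))" by (rule rmean_cong) (rule zq)
    also have "\<dots> = of_real (rmean c n (\<lambda>f. g (Im (z f))))" by (rule rmean_linear[OF lin(3), symmetric])
    also have "rmean c n (\<lambda>f. g (Im (z f))) = rmean y n g"
      unfolding y_def by (rule rmean_map[OF lin(2)])
    finally have zr: "z r = of_real (rmean y n g)" .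
    have "\<bar>rmean y n g\<bar> \<le> rmean y n (\<lambda>s. \<bar>g s\<bar>)" using norm_rmean_le[of y n g] by simp
    also have "\<dots> \<le> rmean y n (\<lambda>s. (1/6) * (s + 0) ^ 4)"
    proof (rule rmean_mono)
      fix s
      show "\<bar>g s\<bar> \<le> (1/6) * (s + 0) ^ 4"
        using mollified_square_bounds(2,3)[of "s\<^sup>2"] by (simp add: g_def \<phi>_def power_mult[symmetric])
    qed
    also have "\<dots> = (1/6) * rmean y n (\<lambda>s. (s + 0) ^ 4)"
      by (rule rmean_linear[symmetric]) (auto simp: linear_iff algebra_simps)
    also have "\<dots> \<le> (1/6) * (3 * (\<Sum>j<n. (y j)\<^sup>2)\<^sup>2)"
      using rmean_fourth_moment[of y n 0] by simp
    also have "(\<Sum>j<n. (y j)\<^sup>2) = \<epsilon>" using gelfand_point_e[OF z] \<epsilon> unfolding y_def by (simp only: of_real_eq_iff)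
    finally show ?thesis using zr by auto
  qed
  define W where "W = (\<Sum>j<n. K * norm (c j) * norm (c j))"
  have W: "W \<ge> 0" unfolding W_def using K_nonneg by (intro sum_nonneg) simp
  have rest: "\<bar>trace_form (r * h)\<bar> \<le> K' / 2 * norm h"
  proof -
    have approx: "\<bar>trace_form (r * h)\<bar> \<le> K' / 2 * norm h + W * norm h * \<eta>" if \<eta>: "\<eta> > 0" for \<eta>
    proof -
      define \<psi> where "\<psi> t = 1 / (\<eta> + \<bar>t\<bar>)" for t :: real
      have "\<eta> + \<bar>t\<bar> \<noteq> 0" for t :: real using abs_ge_zero[of t] \<eta> by linarith
      then have \<psi>: "continuous_on UNIV \<psi>" unfolding \<psi>_def by (intro continuous_intros) auto
      (* a bounded substitute for r / e *)
      define k where "k = calc \<psi> e r"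
      have zk: "\<exists>\<epsilon> \<rho>. z e = of_real \<epsilon> \<and> 0 \<le> \<epsilon> \<and> \<epsilon> \<le> 1 \<and> z r = of_real \<rho> \<and> \<bar>\<rho>\<bar> \<le> \<epsilon>\<^sup>2 / 2 \<and> z k = of_real (\<rho> / (\<eta> + \<epsilon>))"
        if z: "gelfand_point z" for z
      proof -
        define \<epsilon> where "\<epsilon> = (\<Sum>j<n. (Im (z (c j)))\<^sup>2)"
        have \<epsilon>: "z e = of_real \<epsilon>" using gelfand_point_e[OF z] by (simp add: \<epsilon>_def)
        have \<epsilon>0: "\<epsilon> \<ge> 0" unfolding \<epsilon>_def by (intro sum_nonneg) simp
        have "\<epsilon> \<le> 1" using gelfand_point_le_norm[OF z, of e] e_le \<epsilon> \<epsilon>0 by simp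
        moreover obtain \<rho> where \<rho>: "z r = of_real \<rho>" "\<bar>\<rho>\<bar> \<le> \<epsilon>\<^sup>2 / 2" using r_e[OF z \<epsilon>] by blast
        moreover have "z k = of_real (\<rho> / (\<eta> + \<epsilon>))"
          unfolding k_def using gelfand_point_calc[OF z selfadjoint_e \<psi>, of r] \<epsilon> \<epsilon>0 \<rho> by (simp add: \<psi>_def)
        ultimately show ?thesis using \<epsilon> \<epsilon>0 by blast
      qed
      have k_sa: "star k = k"
      proof (rule eq_of_gelfand_points)
        fix z :: "'a \<Rightarrow> complex" assume z: "gelfand_point z"
        then obtain w where "z k = of_real w" using zk by blast
        then show "z (star k) = z k" by (simp add: gelfand_pointD(6)[OF z])
      qed
      have small: "\<epsilon>\<^sup>2 / 2 / (\<eta> + \<epsilon>) \<le> 1 / 2" if "0 \<le> \<epsilon>" "\<epsilon> \<le> 1" for \<epsilon>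
      proof -
        have "\<epsilon>\<^sup>2 \<le> \<epsilon> * 1" unfolding power2_eq_square using that by (intro mult_left_mono) auto
        then show ?thesis using that \<eta> by (simp add: divide_le_eq)
      qed
      have kn: "norm k \<le> 1 / 2"
      proof (rule norm_le_of_gelfand_points)
        fix z :: "'a \<Rightarrow> complex" assume z: "gelfand_point z"
        obtain \<epsilon> \<rho> where *: "0 \<le> \<epsilon>" "\<epsilon> \<le> 1" "\<bar>\<rho>\<bar> \<le> \<epsilon>\<^sup>2 / 2" "z k = of_real (\<rho> / (\<eta> + \<epsilon>))" using zk[OF z] by blast
        have "cmod (z k) = \<bar>\<rho>\<bar> / (\<eta> + \<epsilon>)" unfolding *(4) norm_of_real using * \<eta> by simp
        also have "\<dots> \<le> \<epsilon>\<^sup>2 / 2 / (\<eta> + \<epsilon>)" using * \<eta> by (intro divide_right_mono) auto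
        also have "\<dots> \<le> 1 / 2" using * by (intro small)
        finally show "cmod (z k) \<le> 1 / 2" .
      qed simp
      have dn: "norm (r - e * k) \<le> \<eta>"
      proof (rule norm_le_of_gelfand_points)
        fix z :: "'a \<Rightarrow> complex" assume z: "gelfand_point z"
        obtain \<epsilon> \<rho> where *: "z e = of_real \<epsilon>" "z r = of_real \<rho>" "0 \<le> \<epsilon>" "\<epsilon> \<le> 1" "\<bar>\<rho>\<bar> \<le> \<epsilon>\<^sup>2 / 2" "z k = of_real (\<rho> / (\<eta> + \<epsilon>))"
          using zk[OF z] by blast
        have pos: "\<eta> + \<epsilon> > 0" using * \<eta> by simp
        have "z (r - e * k) = of_real (\<rho> - \<epsilon> * (\<rho> / (\<eta> + \<epsilon>)))"
          by (simp add: gelfand_pointD(2,5)[OF z] *(1,2,6))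
        also have "\<rho> - \<epsilon> * (\<rho> / (\<eta> + \<epsilon>)) = \<eta> * (\<rho> / (\<eta> + \<epsilon>))" using pos by (simp add: field_simps)
        finally have zd: "z (r - e * k) = of_real (\<eta> * (\<rho> / (\<eta> + \<epsilon>)))" .
        have "\<bar>\<rho>\<bar> / (\<eta> + \<epsilon>) \<le> \<epsilon>\<^sup>2 / 2 / (\<eta> + \<epsilon>)" using * pos by (intro divide_right_mono) auto
        also have "\<dots> \<le> 1" using small[OF *(3,4)] by linarith
        finally have "\<eta> * (\<bar>\<rho>\<bar> / (\<eta> + \<epsilon>)) \<le> \<eta> * 1" using \<eta> by (intro mult_left_mono) auto
        then show "cmod (z (r - e * k)) \<le> \<eta>"
          unfolding zd norm_of_real using pos \<eta> by (simp add: abs_mult)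
      qed (use \<eta> in simp)
      have "trace_form (r * h) = trace_form (e * (k * h)) + trace_form ((r - e * k) * h)"
        by (simp add: linear_add[OF linear_trace_form, symmetric] left_diff_distrib mult.assoc)
      moreover have "\<bar>trace_form (e * (k * h))\<bar> \<le> K' / 2 * norm h"
      proof -
        have "norm (k * h) \<le> 1 / 2 * norm h"
          using norm_mult_ineq[of k h] mult_right_mono[OF kn, of "norm h"] by simp
        moreover have "K' \<ge> 0 \<or> h = 0"
        proof (rule disjCI)
          assume "h \<noteq> 0"
          have "0 \<le> K' * norm h" using K'[OF h] by linarith
          then show "K' \<ge> 0" using \<open>h \<noteq> 0\<close> by (simp add: zero_le_mult_iff)
        qed
        ultimately have "K' * norm (k * h) \<le> K' * (1 / 2 * norm h)"
          using mult_left_mono[of "norm (k * h)" "1 / 2 * norm h" K'] by auto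
        then show ?thesis using K'[of "k * h"] h k_sa by simp
      qed
      moreover have "\<bar>trace_form ((r - e * k) * h)\<bar> \<le> W * norm h * \<eta>"
      proof -
        have "norm ((r - e * k) * h) \<le> \<eta> * norm h"
          using norm_mult_ineq[of "r - e * k" h] mult_right_mono[OF dn, of "norm h"] by simp
        then have "W * norm ((r - e * k) * h) \<le> W * (\<eta> * norm h)" using W by (rule mult_left_mono)
        then show ?thesis using trace_form_bound[of "(r - e * k) * h"] by (simp add: W_def mult_ac)
      qed
      ultimately show ?thesis by linarith
    qed
    show ?thesis
    proof (rule field_le_epsilon)
      fix \<epsilon> :: real assume \<epsilon>: "\<epsilon> > 0"
      define M where "M = W * norm h"
      have M: "M \<ge> 0" unfolding M_def using W by simp
      have "M * (\<epsilon> / (M + 1)) \<le> \<epsilon>" using \<epsilon> M by (simp add: field_simps)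
      then show "\<bar>trace_form (r * h)\<bar> \<le> K' / 2 * norm h + \<epsilon>"
        using approx[of "\<epsilon> / (M + 1)"] \<epsilon> M by (simp add: M_def)
    qed
  qed
  have tl: "linear (\<lambda>x. trace_form (x * h))"
    by (intro linearI) (simp_all add: distrib_right linear_add[OF linear_trace_form] linear_scale[OF linear_trace_form])
  have "e = - rmean c n (\<lambda>f. p f * p f + q f)" using rmean_square by (simp add: q_def)
  also have "\<dots> = - rmean c n (\<lambda>f. p f * p f) - r" unfolding rmean_add r_def by simp
  finally have e: "e = - rmean c n (\<lambda>f. p f * p f) - r" .
  have "trace_form (e * h) = - trace_form (rmean c n (\<lambda>f. p f * p f) * h) - trace_form (r * h)"
    using linear_diff[OF tl, of "- rmean c n (\<lambda>f. p f * p f)" r] linear_neg[OF tl, of "rmean c n (\<lambda>f. p f * p f)"]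
    by (simp only: e[symmetric])
  also have "trace_form (rmean c n (\<lambda>f. p f * p f) * h) = rmean c n (\<lambda>f. trace_form (p f * p f * h))"
    by (rule rmean_linear[OF tl])
  finally have "\<bar>trace_form (e * h)\<bar> \<le> \<bar>rmean c n (\<lambda>f. trace_form (p f * p f * h))\<bar> + \<bar>trace_form (r * h)\<bar>" by linarith
  moreover have "norm (rmean c n (\<lambda>f. trace_form (p f * p f * h))) \<le> 3 * K * norm h"
    using norm_pp[OF sum_skew] by (intro norm_rmean_le_const) simp
  ultimately show ?thesis using rest by (simp add: algebra_simps)
qed

text \<open>
  The constant \<open>6 K\<close> is the fixed point of \<open>K' \<mapsto> 3 K + K'/2\<close>, and iterating the
  improvement reaches it in the limit.
\<close>
lemma trace_form_e_bound:
  assumes h: "star h = h"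
  shows "\<bar>trace_form (e * h)\<bar> \<le> 6 * K * norm h"
proof -
  define W where "W = (\<Sum>j<n. K * norm (c j) * norm (c j))"
  have W: "W \<ge> 0" unfolding W_def using K_nonneg by (intro sum_nonneg) simp
  have step: "\<forall>h. star h = h \<longrightarrow> \<bar>trace_form (e * h)\<bar> \<le> (6 * K + W / 2 ^ m) * norm h" for m
  proof (induction m)
    case 0
    show ?case
    proof (intro allI impI)
      fix h
      have "norm (e * h) \<le> 1 * norm h"
        using norm_mult_ineq[of e h] mult_right_mono[OF e_le, of "norm h"] by simp
      then have "W * norm (e * h) \<le> W * norm h" using W by (simp add: mult_left_mono)
      moreover have "\<bar>trace_form (e * h)\<bar> \<le> W * norm (e * h)" unfolding W_def by (rule trace_form_bound)
      moreover have "0 \<le> 6 * K * norm h" using K_nonneg by simp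
      ultimately show "\<bar>trace_form (e * h)\<bar> \<le> (6 * K + W / 2 ^ 0) * norm h" by (simp add: distrib_right)
    qed
  next
    case (Suc m)
    show ?case
    proof (intro allI impI)
      fix h :: 'a assume h: "star h = h"
      have "\<bar>trace_form (e * h)\<bar> \<le> (3 * K + (6 * K + W / 2 ^ m) / 2) * norm h"
        using Suc by (intro trace_form_improve h) blast
      also have "3 * K + (6 * K + W / 2 ^ m) / 2 = 6 * K + W / 2 ^ Suc m" by (simp add: add_divide_distrib)
      finally show "\<bar>trace_form (e * h)\<bar> \<le> (6 * K + W / 2 ^ Suc m) * norm h" .
    qed
  qed
  have "(\<lambda>m. (6 * K + W * (1 / 2) ^ m) * norm h) \<longlonglongrightarrow> (6 * K + W * 0) * norm h"
    by (intro tendsto_intros LIMSEQ_abs_realpow_zero2) simp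
  then have "(\<lambda>m. (6 * K + W / 2 ^ m) * norm h) \<longlonglongrightarrow> 6 * K * norm h" by (simp add: power_one_over)
  then show ?thesis by (rule LIMSEQ_le_const) (use step h in blast)
qed

end

end

section \<open>The representing functionals\<close>

text \<open>
  The linear functionals bounded by \<open>C\<close> form a closed subset of a product of compact
  intervals, so conditions that can be met approximately, finitely many at a time, can be met
  exactly and all at once. In contrast to an extension of Hahn-Banach type, the approximating
  functionals are already defined on the whole space.
\<close>
lemma functional_of_finite_approximations:
  fixes D :: "('v::real_normed_vector \<times> real) set"
  assumes approx: "\<And>F \<epsilon>. finite F \<Longrightarrow> F \<subseteq> D \<Longrightarrow> \<epsilon> > 0 \<Longrightarrow>
    \<exists>\<omega>. linear \<omega> \<and> (\<forall>x. \<bar>\<omega> x\<bar> \<le> C * norm x) \<and> (\<forall>(x, r)\<in>F. \<bar>\<omega> x - r\<bar> \<le> \<epsilon>)"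
  shows "\<exists>\<omega>. bounded_linear \<omega> \<and> (\<forall>(x, r)\<in>D. \<omega> x = r)"
proof -
  define S where "S = (PiE UNIV (\<lambda>x :: 'v. {- (C * norm x)..C * norm x}))"
  define Lin where "Lin = {\<omega> :: 'v \<Rightarrow> real. (\<forall>x y. \<omega> (x + y) = \<omega> x + \<omega> y) \<and> (\<forall>r x. \<omega> (r *\<^sub>R x) = r * \<omega> x)}"
  have "compact S"
    using compactin_PiE[of "\<lambda>_. euclidean" UNIV "\<lambda>x :: 'v. {- (C * norm x)..C * norm x}"]
    unfolding S_def euclidean_product_topology by simp
  moreover have "closed Lin" unfolding Lin_def
    by (intro closed_Collect_conj closed_Collect_all closed_Collect_eq continuous_intros continuous_on_product_coordinates)
  ultimately have comp: "compact (S \<inter> Lin)" by (rule compact_Int_closed)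
  define A where "A = (\<lambda>((x, r), k :: nat). {\<omega> :: 'v \<Rightarrow> real. \<bar>\<omega> x - r\<bar> \<le> 1 / Suc k})"
  have "S \<inter> Lin \<inter> (\<Inter>i\<in>D \<times> UNIV. A i) \<noteq> {}"
  proof (rule compact_imp_fip_image[OF comp])
    fix i
    show "closed (A i)" unfolding A_def
      by (cases i; cases "fst i")
        (simp, intro closed_Collect_le continuous_intros continuous_on_product_coordinates)
  next
    fix J assume J: "finite J" "J \<subseteq> D \<times> (UNIV :: nat set)"
    have "finite (snd ` J)" using J(1) by simp
    then obtain N where N: "\<forall>k\<in>snd ` J. k \<le> N" unfolding finite_nat_set_iff_bounded_le by blast
    have "finite (fst ` J)" "fst ` J \<subseteq> D" using J by auto
    then obtain \<omega> where \<omega>: "linear \<omega>" "\<And>x. \<bar>\<omega> x\<bar> \<le> C * norm x" "\<forall>(x, r)\<in>fst ` J. \<bar>\<omega> x - r\<bar> \<le> 1 / Suc N"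
      using approx[of "fst ` J" "1 / Suc N"] by auto
    have "\<omega> \<in> S" unfolding S_def using \<omega>(2) by (auto simp: PiE_iff abs_le_iff minus_le_iff)
    moreover have "\<omega> \<in> Lin" unfolding Lin_def using linear_add[OF \<omega>(1)] linear_scale[OF \<omega>(1)] by simp
    moreover have "\<omega> \<in> A i" if i: "i \<in> J" for i
    proof -
      obtain x r k where i': "i = ((x, r), k)" by (metis surj_pair)
      have "(x, r) \<in> fst ` J" "k \<in> snd ` J" using i unfolding i' by force+
      then have "\<bar>\<omega> x - r\<bar> \<le> 1 / Suc N" "k \<le> N" using \<omega>(3) N by auto
      moreover have "1 / real (Suc N) \<le> 1 / real (Suc k)" using \<open>k \<le> N\<close> by (intro divide_left_mono) auto
      ultimately show ?thesis unfolding i' A_def by simp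
    qed
    ultimately show "S \<inter> Lin \<inter> (\<Inter>i\<in>J. A i) \<noteq> {}" by blast
  qed
  then obtain \<omega> where \<omega>: "\<omega> \<in> S" "\<omega> \<in> Lin" "\<And>i. i \<in> D \<times> UNIV \<Longrightarrow> \<omega> \<in> A i" by blast
  have b: "\<bar>\<omega> x\<bar> \<le> C * norm x" for x
  proof -
    have "\<omega> x \<in> {- (C * norm x)..C * norm x}" using \<omega>(1) unfolding S_def by (simp add: PiE_iff)
    then show ?thesis by (simp add: abs_le_iff minus_le_iff)
  qed
  have "bounded_linear \<omega>"
    using \<omega>(2) b by (intro bounded_linear_intro[of _ C]) (simp_all add: Lin_def mult.commute)
  moreover have "\<omega> x = r" if xr: "(x, r) \<in> D" for x r
  proof -
    have le: "\<bar>\<omega> x - r\<bar> \<le> 1 / Suc k" for k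
      using \<omega>(3)[of "((x, r), k)"] xr by (simp add: A_def)
    have "\<bar>\<omega> x - r\<bar> \<le> 0"
    proof (rule field_le_epsilon)
      fix \<epsilon> :: real assume "\<epsilon> > 0"
      then obtain k where "1 / Suc k < \<epsilon>" using nat_approx_posE by blast
      then show "\<bar>\<omega> x - r\<bar> \<le> 0 + \<epsilon>" using le[of k] by linarith
    qed
    then show ?thesis by simp
  qed
  ultimately show ?thesis by blast
qed

context local_form
begin

lemma selfadjoint_left_functional:
  "\<exists>\<Lambda>. bounded_linear \<Lambda> \<and> (\<forall>a y. star a = a \<longrightarrow> V a y = \<Lambda> (a * y))"
proof -
  define g where "g = (\<lambda>(a, y). (a * y, V a y))"
  define D where "D = g ` ({a. star a = a} \<times> UNIV)"
  have "\<exists>\<Lambda>. bounded_linear \<Lambda> \<and> (\<forall>(x, r)\<in>D. \<Lambda> x = r)"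
  proof (rule functional_of_finite_approximations)
    fix F and \<epsilon> :: real assume F: "finite F" "F \<subseteq> D" and \<epsilon>: "\<epsilon> > 0"
    then obtain G where G: "G \<subseteq> {a. star a = a} \<times> UNIV" "finite G" "F = g ` G"
      unfolding D_def by (meson finite_subset_image)
    define M where "M = K * (\<Sum>d\<in>G. norm (snd d)) + 1"
    have M: "M > 0" unfolding M_def using K_nonneg by (intro add_nonneg_pos mult_nonneg_nonneg sum_nonneg) auto
    have "finite (fst ` G)" "\<epsilon> / M > 0" using G(2) \<epsilon> M by auto
    then obtain e where e: "star e = e" "norm e \<le> 1" "\<forall>x\<in>fst ` G. norm (e * x - x) \<le> \<epsilon> / M"
      using approximate_unit by blast
    show "\<exists>\<omega>. linear \<omega> \<and> (\<forall>x. \<bar>\<omega> x\<bar> \<le> K * norm x) \<and> (\<forall>(x, r)\<in>F. \<bar>\<omega> x - r\<bar> \<le> \<epsilon>)"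
    proof (intro exI[of _ "V e"] conjI allI ballI)
      show "linear (V e)" by (rule linearI) (simp_all add: V_simps)
      show "\<bar>V e x\<bar> \<le> K * norm x" for x using bound_mono[OF e(2) order_refl, of x] by simp
      fix d assume "d \<in> F"
      then obtain a y where d: "(a, y) \<in> G" "d = (a * y, V a y)" using G(3) by (auto simp: g_def)
      then have a: "star a = a" "norm (e * a - a) \<le> \<epsilon> / M" using G(1) e(3) by force+
      have "V e (a * y) - V a y = V (e * a - a) y"
        using balanced[OF a(1), of e y] by (simp add: V_simps mult.commute)
      moreover have "\<bar>V (e * a - a) y\<bar> \<le> K * (\<epsilon> / M) * norm y" by (rule bound_mono[OF a(2) order_refl])
      moreover have "K * (\<epsilon> / M) * norm y \<le> \<epsilon>"
      proof -
        have "norm y \<le> (\<Sum>d\<in>G. norm (snd d))" using member_le_sum[OF d(1), of "\<lambda>d. norm (snd d)"] G(2) by simp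
        then have "K * norm y \<le> M" using mult_left_mono[OF _ K_nonneg] unfolding M_def by fastforce
        then have "\<epsilon> * (K * norm y) \<le> \<epsilon> * M" using \<epsilon> by (intro mult_left_mono) auto
        then show ?thesis using M by (simp add: field_simps)
      qed
      ultimately show "case d of (x, r) \<Rightarrow> \<bar>V e x - r\<bar> \<le> \<epsilon>" using d(2) by simp
    qed
  qed
  then obtain \<Lambda> where \<Lambda>: "bounded_linear \<Lambda>" "\<forall>(x, r)\<in>D. \<Lambda> x = r" by blast
  have "V a y = \<Lambda> (a * y)" if "star a = a" for a y
  proof -
    have "g (a, y) \<in> D" unfolding D_def using that by blast
    then show ?thesis using \<Lambda>(2) by (auto simp: g_def)
  qed
  with \<Lambda>(1) show ?thesis by blast
qed

text \<open>
  For a finite set \<open>P\<close> of skew elements let \<open>T = \<Sum> \<bar>x\<bar>\<^sup>2\<close> and take for the \<open>c\<^sub>j\<close> the elements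
  \<open>x / \<surd>(\<eta> + T)\<close>, \<open>x \<in> P\<close>. Then \<open>e = \<Sum> \<bar>c\<^sub>j\<bar>\<^sup>2 = T / (\<eta> + T)\<close> is an approximate unit for \<open>P\<close>, and
  \<open>x \<mapsto> w (e Re x)\<close>, with \<open>w\<close> the trace form of the \<open>c\<^sub>j\<close> and \<open>Re x = (x + x\<^sup>*)/2\<close>, is bounded by \<open>6 K\<close> and takes the value
  \<open>V (e b) (e d) \<approx> V b d\<close> at \<open>b d\<close>.
\<close>
lemma skew_functional:
  "\<exists>\<omega>. bounded_linear \<omega> \<and> (\<forall>b d. star b = - b \<longrightarrow> star d = - d \<longrightarrow> V b d = \<omega> (b * d))"
proof -
  define Sk where "Sk = {b :: 'a. star b = - b}"
  define g where "g = (\<lambda>(b, d). (b * d, V b d))"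
  define D where "D = g ` (Sk \<times> Sk)"
  have "\<exists>\<omega>. bounded_linear \<omega> \<and> (\<forall>(x, r)\<in>D. \<omega> x = r)"
  proof (rule functional_of_finite_approximations)
    fix F and \<epsilon> :: real assume F: "finite F" "F \<subseteq> D" and \<epsilon>: "\<epsilon> > 0"
    then obtain G where G: "G \<subseteq> Sk \<times> Sk" "finite G" "F = g ` G"
      unfolding D_def by (meson finite_subset_image)
    define P where "P = fst ` G \<union> snd ` G"
    have P: "finite P" "P \<subseteq> Sk" using G by (auto simp: P_def)
    have P_skew: "star x = - x" if "x \<in> P" for x using P(2) that by (auto simp: Sk_def)
    define B where "B = (\<Sum>x\<in>P. norm x)"
    have B0: "B \<ge> 0" unfolding B_def by (intro sum_nonneg) simp
    have B: "norm x \<le> B" if "x \<in> P" for x unfolding B_def using member_le_sum[OF that, of norm] P(1) by simp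
    (* each of the two error terms below is at most K B delta *)
    define \<delta> where "\<delta> = \<epsilon> / (2 * K * B + 1)"
    have M: "2 * K * B + 1 > 0" using K_nonneg B0 by (simp add: add_nonneg_pos)
    have \<delta>: "\<delta> > 0" unfolding \<delta>_def using \<epsilon> M by simp
    define \<eta> where "\<eta> = \<delta>\<^sup>2"
    have \<eta>: "\<eta> > 0" "sqrt \<eta> = \<delta>" using \<delta> by (simp_all add: \<eta>_def)
    define T where "T = (\<Sum>x\<in>P. star x * x)"
    have T: "star T = T" using sum_star_mult_self_selfadjoint[OF P(1)] by (simp only: T_def)
    define \<phi> where "\<phi> t = 1 / sqrt (\<eta> + \<bar>t\<bar>)" for t :: real
    have pos: "\<eta> + \<bar>t\<bar> > 0" for t :: real using \<eta>(1) by (simp add: add_pos_nonneg)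
    have \<phi>: "continuous_on UNIV \<phi>"
    proof -
      have "sqrt (\<eta> + \<bar>t\<bar>) \<noteq> 0" for t :: real using pos[of t] by simp
      then show ?thesis unfolding \<phi>_def by (intro continuous_intros) auto
    qed
    define C where "C = calc \<phi> T"
    define n where "n = card P"
    obtain p where p: "bij_betw p {..<n} P"
      using ex_bij_betw_nat_finite[OF P(1)] unfolding n_def atLeast0LessThan by blast
    define c where "c j = (if j < n then C (p j) else 0)" for j
    define e where "e = - (\<Sum>j<n. c j * c j)"
    have C_skew: "star (C x) = - C x" if "star x = - x" for x
    proof (rule eq_of_gelfand_points)
      fix z :: "'a \<Rightarrow> complex" assume z: "gelfand_point z"
      have "z (star (C x)) = z (C (star x))" unfolding C_def star_calc[OF T \<phi>] ..
      then show "z (star (C x)) = z (- C x)"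
        unfolding that by (simp add: C_def gelfand_point_calc[OF z T \<phi>] gelfand_pointD(7)[OF z])
    qed
    have c_skew: "star (c j) = - c j" for j
    proof (cases "j < n")
      case True
      then have "p j \<in> P" using p by (auto simp: bij_betw_def)
      then show ?thesis using True C_skew[OF P_skew] by (simp add: c_def)
    qed (simp add: c_def)
    have e_C: "e = - (\<Sum>x\<in>P. C x * C x)"
      using sum.reindex_bij_betw[OF p, of "\<lambda>x. C x * C x"] by (simp add: e_def c_def)
    have ze: "z e = of_real (\<bar>Re (z T)\<bar> / (\<eta> + \<bar>Re (z T)\<bar>))" if z: "gelfand_point z" for z
    proof -
      define t where "t = (\<Sum>x\<in>P. (cmod (z x))\<^sup>2)"
      have t: "t \<ge> 0" unfolding t_def by (intro sum_nonneg) simp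
      have zT: "z T = of_real t"
        unfolding T_def t_def by (simp add: gelfand_pointD(8)[OF z] gelfand_point_norm_square[OF z] del: of_real_power)
      have "z (C x * C x) = - of_real ((\<phi> t)\<^sup>2 * (cmod (z x))\<^sup>2)" if "x \<in> P" for x
      proof -
        have "- (z x * z x) = of_real ((cmod (z x))\<^sup>2)"
          using gelfand_point_norm_square[OF z, of x] P_skew[OF that]
          by (simp add: gelfand_pointD(5,7)[OF z] del: of_real_power)
        then have "z x * z x = - of_real ((cmod (z x))\<^sup>2)" by (simp only: minus_equation_iff[of "z x * z x"])
        moreover have "z (C x * C x) = of_real ((\<phi> t)\<^sup>2) * (z x * z x)"
          by (simp add: C_def gelfand_pointD(5)[OF z] gelfand_point_calc[OF z T \<phi>] zT power2_eq_square)
        ultimately show ?thesis by simp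
      qed
      then have "z e = of_real ((\<phi> t)\<^sup>2 * t)"
        by (simp add: e_C gelfand_pointD(7,8)[OF z] sum_negf t_def sum_distrib_left del: of_real_power)
      also have "(\<phi> t)\<^sup>2 * t = \<bar>t\<bar> / (\<eta> + \<bar>t\<bar>)" using t pos[of t] by (simp add: \<phi>_def power_divide)
      finally show ?thesis unfolding zT by simp
    qed
    have e1: "norm e \<le> 1"
    proof (rule norm_le_of_gelfand_points)
      fix z :: "'a \<Rightarrow> complex" assume z: "gelfand_point z"
      show "cmod (z e) \<le> 1"
        unfolding ze[OF z] norm_of_real using pos[of "Re (z T)"] \<eta>(1) by (simp add: divide_le_eq)
    qed simp
    have e_sa: "star e = e" by (rule selfadjoint_e[OF c_skew e_def e1])
    have err: "norm (e * x - x) \<le> \<delta>" if "x \<in> P" for x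
      unfolding \<eta>(2)[symmetric] by (rule approximate_unit_error[OF P(1) that \<eta>(1) T_def]) (rule ze)
    define \<omega> where "\<omega> x = trace_form c n (e * ((1/2) *\<^sub>R (x + star x)))" for x
    note lt = linear_trace_form[OF c_skew e_def e1]
    show "\<exists>\<omega>. linear \<omega> \<and> (\<forall>x. \<bar>\<omega> x\<bar> \<le> 6 * K * norm x) \<and> (\<forall>(x, r)\<in>F. \<bar>\<omega> x - r\<bar> \<le> \<epsilon>)"
    proof (intro exI[of _ \<omega>] conjI allI ballI)
      show "linear \<omega>"
      proof (rule linearI)
        fix x y :: 'a and r :: real
        have "e * ((1/2) *\<^sub>R ((x + y) + star (x + y)))
            = e * ((1/2) *\<^sub>R (x + star x)) + e * ((1/2) *\<^sub>R (y + star y))"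
          by (simp add: algebra_simps)
        then show "\<omega> (x + y) = \<omega> x + \<omega> y" unfolding \<omega>_def by (simp only: linear_add[OF lt])
        have "e * ((1/2) *\<^sub>R (r *\<^sub>R x + star (r *\<^sub>R x))) = r *\<^sub>R (e * ((1/2) *\<^sub>R (x + star x)))"
          by (simp add: algebra_simps)
        then show "\<omega> (r *\<^sub>R x) = r *\<^sub>R \<omega> x" unfolding \<omega>_def by (simp only: linear_scale[OF lt])
      qed
      fix x :: 'a
      have "norm ((1/2) *\<^sub>R (x + star x)) \<le> norm x" using norm_triangle_ineq[of x "star x"] by simp
      then have "6 * K * norm ((1/2) *\<^sub>R (x + star x)) \<le> 6 * K * norm x" using K_nonneg by (intro mult_left_mono) auto
      moreover have "star ((1/2) *\<^sub>R (x + star x)) = (1/2) *\<^sub>R (x + star x)" by (simp add: add.commute)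
      ultimately show "\<bar>\<omega> x\<bar> \<le> 6 * K * norm x"
        unfolding \<omega>_def using trace_form_e_bound[OF c_skew e_def e1] order_trans by blast
    next
      fix q assume "q \<in> F"
      then obtain b d where q: "(b, d) \<in> G" "q = (b * d, V b d)" using G(3) by (auto simp: g_def)
      then have bd: "b \<in> P" "d \<in> P" by (force simp: P_def)+
      have half: "(1/2) *\<^sub>R (b * d + star (b * d)) = b * d"
        by (simp add: P_skew[OF bd(1)] P_skew[OF bd(2)] flip: scaleR_2)
      have "\<omega> (b * d) = trace_form c n (b * (e * d))" unfolding \<omega>_def half by (simp only: ac_simps)
      also have "\<dots> = V (e * b) (e * d)" by (rule trace_form_mult_skew[OF c_skew e_def e1 P_skew[OF bd(1)]])
      finally have "\<omega> (b * d) - V b d = V (e * b - b) (e * d) + V b (e * d - d)" by (simp add: V_simps)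
      moreover have "norm (e * d) \<le> B"
        using norm_mult_ineq[of e d] mult_right_mono[OF e1, of "norm d"] B[OF bd(2)] by simp
      then have "\<bar>V (e * b - b) (e * d)\<bar> \<le> K * \<delta> * B" by (rule bound_mono[OF err[OF bd(1)]])
      moreover have "\<bar>V b (e * d - d)\<bar> \<le> K * B * \<delta>" by (rule bound_mono[OF B[OF bd(1)] err[OF bd(2)]])
      moreover have "K * \<delta> * B + K * B * \<delta> \<le> \<epsilon>"
      proof -
        have "(2 * K * B + 1) * \<delta> = \<epsilon>" unfolding \<delta>_def using M by simp
        then show ?thesis using \<delta> by (simp add: algebra_simps)
      qed
      ultimately have "\<bar>\<omega> (b * d) - V b d\<bar> \<le> \<epsilon>" by linarith
      then show "case q of (x, r) \<Rightarrow> \<bar>\<omega> x - r\<bar> \<le> \<epsilon>" using q(2) by simp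
    qed
  qed
  then obtain \<omega> where \<omega>: "bounded_linear \<omega>" "\<forall>(x, r)\<in>D. \<omega> x = r" by blast
  have "V b d = \<omega> (b * d)" if "star b = - b" "star d = - d" for b d
  proof -
    have "g (b, d) \<in> D" unfolding D_def Sk_def using that by blast
    then show ?thesis using \<omega>(2) by (auto simp: g_def)
  qed
  with \<omega>(1) show ?thesis by blast
qed

end

text \<open>
  With \<open>x = a + b\<close> and \<open>y = c + d\<close> split into self-adjoint and skew parts,
  \<open>V x y = V a y + V b c + V b d\<close>, and the three terms are functionals of \<open>a y\<close>, \<open>c b\<close> and \<open>b d\<close>. These products are
  linear combinations of \<open>x y\<close>, \<open>x y\<^sup>*\<close> and their adjoints, because
  \<open>x\<^sup>* y = (x y\<^sup>*)\<^sup>*\<close>.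
\<close>
theorem theorem2p4:
  fixes V :: "'a::{real_cstar_algebra, comm_ring} \<Rightarrow> 'a \<Rightarrow> real"
  assumes "orthogonal_form V"
  shows "\<exists>\<phi>\<^sub>1 \<phi>\<^sub>2 :: 'a \<Rightarrow> real. bounded_linear \<phi>\<^sub>1 \<and> bounded_linear \<phi>\<^sub>2 \<and>
           (\<forall>x y. V x y = \<phi>\<^sub>1 (x * y) + \<phi>\<^sub>2 (x * star y))"
proof -
  have bil: "bounded_bilinear V" and orth: "\<And>a b. orthogonal_elements a b \<Longrightarrow> V a (star b) = 0"
    using assms unfolding orthogonal_form_def by blast+
  have loc: "V a b = 0" if "a * b = 0" for a b
    using orth[of a "star b"] that by (simp add: orthogonal_elements_def mult.commute)
  obtain K where K: "K \<ge> 0" "\<And>a b. norm (V a b) \<le> norm a * norm b * K"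
    using bounded_bilinear.nonneg_bounded[OF bil] by blast
  interpret V: local_form V K
    by (rule local_form.intro) (use bil loc K in \<open>auto simp: mult_ac\<close>)
  interpret flip: local_form "\<lambda>a b. V b a" K
  proof (rule local_form.intro)
    show "bounded_bilinear (\<lambda>a b. V b a)" by (rule bounded_bilinear.flip[OF bil])
    show "\<bar>V b a\<bar> \<le> K * norm a * norm b" for a b using K(2)[of b a] by (simp add: mult_ac)
    show "V b a = 0" if "a * b = 0" for a b using loc that by (simp add: mult.commute)
  qed (rule K)
  obtain \<Lambda>\<^sub>1 where L1: "bounded_linear \<Lambda>\<^sub>1" "\<And>a y. star a = a \<Longrightarrow> V a y = \<Lambda>\<^sub>1 (a * y)"
    using V.selfadjoint_left_functional by blast
  obtain \<Lambda>\<^sub>2 where L2: "bounded_linear \<Lambda>\<^sub>2" "\<And>a x. star a = a \<Longrightarrow> V x a = \<Lambda>\<^sub>2 (a * x)"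
    using flip.selfadjoint_left_functional by blast
  obtain \<omega> where om: "bounded_linear \<omega>" "\<And>b d. star b = - b \<Longrightarrow> star d = - d \<Longrightarrow> V b d = \<omega> (b * d)"
    using V.skew_functional by blast
  have star: "bounded_linear (star :: 'a \<Rightarrow> 'a)" by (rule bounded_linear_intro[of _ 1]) simp_all
  define \<phi>\<^sub>1 where "\<phi>\<^sub>1 u = \<Lambda>\<^sub>1 ((1/2) *\<^sub>R u) + \<Lambda>\<^sub>2 ((1/4) *\<^sub>R (u - star u)) + \<omega> ((1/4) *\<^sub>R (u + star u))" for u
  define \<phi>\<^sub>2 where "\<phi>\<^sub>2 v = \<Lambda>\<^sub>1 ((1/2) *\<^sub>R star v) + \<Lambda>\<^sub>2 ((1/4) *\<^sub>R (v - star v)) - \<omega> ((1/4) *\<^sub>R (v + star v))" for v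
  note bl = bounded_linear_add bounded_linear_sub bounded_linear_compose[OF L1(1)] bounded_linear_compose[OF L2(1)]
    bounded_linear_compose[OF om(1)] bounded_linear_compose[OF bounded_linear_scaleR_right] bounded_linear_ident star
  have "bounded_linear \<phi>\<^sub>1" unfolding \<phi>\<^sub>1_def by (intro bl)
  moreover have "bounded_linear \<phi>\<^sub>2" unfolding \<phi>\<^sub>2_def by (intro bl)
  moreover have "V x y = \<phi>\<^sub>1 (x * y) + \<phi>\<^sub>2 (x * star y)" for x y
  proof -
    define a b c d where "a = (1/2) *\<^sub>R (x + star x)" and "b = (1/2) *\<^sub>R (x - star x)"
      and "c = (1/2) *\<^sub>R (y + star y)" and "d = (1/2) *\<^sub>R (y - star y)"
    have sa: "star a = a" "star c = c" and sk: "star b = - b" "star d = - d"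
      by (simp_all add: a_def b_def c_def d_def algebra_simps)
    have xy: "x = a + b" "y = c + d"
      by (simp_all add: a_def b_def c_def d_def algebra_simps flip: scaleR_add_left)
    have "V x y = V a y + V b c + V b d"
      unfolding xy by (simp add: V.V_simps)
    also have "\<dots> = \<Lambda>\<^sub>1 (a * y) + \<Lambda>\<^sub>2 (c * b) + \<omega> (b * d)" by (simp only: L1(2)[OF sa(1)] L2(2)[OF sa(2)] om(2)[OF sk])
    also have "a * y = (1/2) *\<^sub>R (x * y) + (1/2) *\<^sub>R star (x * star y)"
      by (simp add: a_def algebra_simps)
    also have "c * b = (1/4) *\<^sub>R (x * y - star (x * y)) + (1/4) *\<^sub>R (x * star y - star (x * star y))"
      by (simp add: b_def c_def algebra_simps)
    also have "b * d = (1/4) *\<^sub>R (x * y + star (x * y)) - (1/4) *\<^sub>R (x * star y + star (x * star y))"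
      by (simp add: b_def d_def algebra_simps)
    also have "\<Lambda>\<^sub>1 ((1/2) *\<^sub>R (x * y) + (1/2) *\<^sub>R star (x * star y))
        + \<Lambda>\<^sub>2 ((1/4) *\<^sub>R (x * y - star (x * y)) + (1/4) *\<^sub>R (x * star y - star (x * star y)))
        + \<omega> ((1/4) *\<^sub>R (x * y + star (x * y)) - (1/4) *\<^sub>R (x * star y + star (x * star y)))
        = \<phi>\<^sub>1 (x * y) + \<phi>\<^sub>2 (x * star y)"
      unfolding linear_add[OF bounded_linear.linear[OF L1(1)]] linear_add[OF bounded_linear.linear[OF L2(1)]]
        linear_diff[OF bounded_linear.linear[OF om(1)]] \<phi>\<^sub>1_def \<phi>\<^sub>2_def by simp
    finally show ?thesis .
  qed
  ultimately show ?thesis by blast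
qed

end
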